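(* If $C$ is a Type II code of length $24$, then $C$ has one of the following nine tetrad systems: $$\emptyset,\quad 6d_4,\quad 4d_6,\quad 3d_8,\quad 2d_{12},\quad d_{24},\quad 2e_7+d_{10},\quad 3e_8,\quad e_8+d_{16}.$$
   Context: A binary linear code of length $n$ is a subspace $C\subseteq\mathbb{F}_2^n$; $\mathrm{wt}$ denotes Hamming weight. $C$ is of Type II if $C=C^\perp$ (with respect to $(v,w)=\sum_jv_jw_j$) and $4\mid\mathrm{wt}(c)$ for all $c\in C$. For a code $C$ all of whose weights are divisible by $4$, the tetrad system of $C$ is the set $C_4$ of codewords of weight $4$, and the tetrad subcode is the subcode $\mathcal{C}_4(C)$ of $C$ generated by $C_4$. Let $d_{2k}$ ($k\ge2$) be the code of all words $c\in\mathbb{F}_2^{2k}$ of weight divisible by $4$ with $c_{2j-1}=c_{2j}$ for $j=1,\dots,k$; let $e_7$ be the $[7,3,4]$ dual Hamming code and $e_8$ the $[8,4,4]$ extended Hamming code. Saying that $C$ has the tetrad system $\emptyset$ means $C_4=\emptyset$; saying that $C$ has tetrad system $m_1a_1+m_2a_2+\cdots$ (with each $a_i$ one of the codes $d_{2k},e_7,e_8$ and each $m_i$ a positive integer) means that, up to a permutation of coordinates, $\mathcal{C}_4(C)$ is the direct sum of $m_1$ copies of $a_1$, $m_2$ copies of $a_2$, etc., placed on disjoint sets of coordinates. (In each nonempty case listed the lengths add up to $24$.) *)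

theory Defs
  imports
    "HOL-Library.Z2"
    "HOL-Combinatorics.Permutations"
    "Jordan_Normal_Form.VS_Connect"
    "Jordan_Normal_Form.Matrix_Kernel"
begin

text \<open>Words of length \<open>n\<close> are elements of \<open>carrier_vec n\<close> over the two-element field \<open>bit\<close>.
  Coordinates are numbered \<open>0, \<dots>, n - 1\<close>.\<close>

definition linear_code :: "nat \<Rightarrow> bit vec set \<Rightarrow> bool" where
  "linear_code n C \<longleftrightarrow> VectorSpace.subspace class_ring C (module_vec TYPE(bit) n)"

definition wt :: "bit vec \<Rightarrow> nat" where
  "wt c = card {i. i < dim_vec c \<and> c $ i \<noteq> 0}"

definition dual_code :: "nat \<Rightarrow> bit vec set \<Rightarrow> bit vec set" where
  "dual_code n C = {v \<in> carrier_vec n. \<forall>w\<in>C. v \<bullet> w = 0}"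

definition type_II :: "nat \<Rightarrow> bit vec set \<Rightarrow> bool" where
  "type_II n C \<longleftrightarrow> linear_code n C \<and> C = dual_code n C \<and> (\<forall>c\<in>C. 4 dvd wt c)"

definition tetrads :: "bit vec set \<Rightarrow> bit vec set" where
  "tetrads C = {c \<in> C. wt c = 4}"

definition tetrad_subcode :: "nat \<Rightarrow> bit vec set \<Rightarrow> bit vec set" where
  "tetrad_subcode n C =
     LinearCombinations.module.span class_ring (module_vec TYPE(bit) n) (tetrads C)"

text \<open>\<open>d_code k\<close> is the code of length \<open>2k\<close> usually written \<open>d\<close> with subscript \<open>2k\<close>; thus
  \<open>d_code 2\<close> has length 4 and \<open>d_code 12\<close> has length 24.\<close>

definition d_code :: "nat \<Rightarrow> bit vec set" where
  "d_code k = {c \<in> carrier_vec (2 * k). 4 dvd wt c \<and> (\<forall>j<k. c $ (2 * j) = c $ (2 * j + 1))}"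

text \<open>Column \<open>j\<close> of the parity check matrix of the \<open>[7,4,3]\<close> Hamming code consists of the
  binary digits of \<open>j + 1\<close>.\<close>

definition hamming_check :: "bit mat" where
  "hamming_check = mat 3 7 (\<lambda>(i, j). of_nat ((j + 1) div 2 ^ i))"

definition hamming_code :: "bit vec set" where
  "hamming_code = mat_kernel hamming_check"

definition e7_code :: "bit vec set" where
  "e7_code = dual_code 7 hamming_code"

definition e8_code :: "bit vec set" where
  "e8_code = {c @\<^sub>v vec 1 (\<lambda>_. \<Sum>i<7. c $ i) | c. c \<in> hamming_code}"

definition code_sum :: "bit vec set \<Rightarrow> bit vec set \<Rightarrow> bit vec set" where
  "code_sum A B = {u @\<^sub>v v | u v. u \<in> A \<and> v \<in> B}"

definition code_sum_list :: "bit vec set list \<Rightarrow> bit vec set" where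
  "code_sum_list As = foldr code_sum As {vNil}"

definition permute_word :: "(nat \<Rightarrow> nat) \<Rightarrow> bit vec \<Rightarrow> bit vec" where
  "permute_word p c = vec (dim_vec c) (\<lambda>i. c $ p i)"

text \<open>\<open>As\<close> lists the summands with multiplicity, in an arbitrary order.  The empty tetrad system
  is not covered by this predicate: it is the condition \<open>tetrads C = {}\<close>.\<close>

definition has_tetrad_system :: "nat \<Rightarrow> bit vec set \<Rightarrow> bit vec set list \<Rightarrow> bool" where
  "has_tetrad_system n C As \<longleftrightarrow>
     (\<exists>p. p permutes {..<n} \<and> permute_word p ` tetrad_subcode n C = code_sum_list As)"

end

theory Submission
  imports Defs
begin

text \<open>Writing \<open>s\<close> for the sum of the signs \<open>(-1)\<^bsup>c\<^sub>j\<^esup>\<close>, self-duality evaluates the sums over the code of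
  \<open>(-1)\<^bsup>c\<^sub>i\<^esup> s\<close> and \<open>(-1)\<^bsup>c\<^sub>i\<^esup> s\<^sup>3\<close>; for length 24 this determines the number \<open>r\<close> of tetrads through
  the coordinate \<open>i\<close> from the total number of tetrads, so \<open>r\<close> is the same for all coordinates.  Two
  tetrads through a point \<open>x\<close> meet in exactly one further point.  If all tetrads through \<open>x\<close> share a
  second point, then \<open>x\<close> lies in a component \<open>d_code (r + 1)\<close>.  Otherwise three of them span a copy
  of the tetrads of \<open>e7_code\<close>, and a further tetrad through \<open>x\<close> enlarges it to a copy of those of
  \<open>e8_code\<close>; here \<open>r\<close> is 4 or 7.  For each \<open>r\<close> the component lengths must add up to 24.\<close>

section \<open>Words and sets\<close>

text \<open>Self-duality acts through orthogonality of characters: a product of coordinate signs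
  averages to 1 over the code if the indices occurring an odd number of times form a codeword, and
  to 0 otherwise. The average of (-1)^(c_i) s^3 is thus a count of index triples, and tetrads
  through \<open>i\<close> are the only codewords it can see. Odd powers of s are the right ones:
  complementing a word negates both s and the sign at \<open>i\<close>, and since the weights 8, 12,
  16 are symmetric about 12, a single odd cubic removes all three, so their unknown frequencies
  never enter.

  The constancy of \<open>r\<close> has a local and a global effect. Locally it is a saturation
  criterion: a configuration with \<open>r\<close> tetrads through each of its points is met by no
  other tetrad, so components need not be compared with one another. Globally it ties the components
  together: \<open>e7_code\<close> can occur only beside \<open>d_code 5\<close>, and
  \<open>e8_code\<close> only beside \<open>d_code 8\<close>, which is why exactly two systems in
  the list are mixed.\<close>

definition supp :: "bit vec \<Rightarrow> nat set" where
  "supp c = {i. i < dim_vec c \<and> c $ i \<noteq> 0}"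

text \<open>An indicator read along a list of coordinates: permuting coordinates becomes a choice of
  list, and placing codes side by side becomes appending lists.\<close>

definition word :: "nat list \<Rightarrow> nat set \<Rightarrow> bit vec" where
  "word xs B = vec (length xs) (\<lambda>i. of_bool (xs ! i \<in> B))"

lemma wt_eq_card_supp: "wt c = card (supp c)"
  by (simp add: wt_def supp_def)

lemma supp_subset: "c \<in> carrier_vec n \<Longrightarrow> supp c \<subseteq> {..<n}"
  by (auto simp: supp_def)

lemma supp_zero [simp]: "supp (0\<^sub>v n) = {}"
  by (auto simp: supp_def)

lemma supp_add:
  assumes "u \<in> carrier_vec n" "v \<in> carrier_vec n"
  shows "supp (u + v) = sym_diff (supp u) (supp v)"
proof -
  have bit: "x + y = 1 \<longleftrightarrow> (x = 1) \<noteq> (y = 1)" for x y :: bit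
    by (cases x; cases y) auto
  show ?thesis
    using assms by (auto simp: supp_def bit simp del: add_bit_eq_xor)
qed

lemma dim_word [simp]: "dim_vec (word xs B) = length xs"
  by (simp add: word_def)

lemma word_carrier [simp]: "word xs B \<in> carrier_vec (length xs)"
  by (simp add: word_def)

lemma index_word [simp]: "i < length xs \<Longrightarrow> word xs B $ i = of_bool (xs ! i \<in> B)"
  by (simp add: word_def)

lemma supp_word_upt: "supp (word [0..<n] B) = B \<inter> {..<n}"
  by (auto simp: supp_def)

lemma word_upt_supp: "c \<in> carrier_vec n \<Longrightarrow> word [0..<n] (supp c) = c"
  by (intro eq_vecI) (auto simp: supp_def)

lemma word_upt_carrier: "word [0..<n] B \<in> carrier_vec n"
  using word_carrier[of "[0..<n]" B] by simp

lemma index_word_upt: "i < n \<Longrightarrow> word [0..<n] B $ i = of_bool (i \<in> B)"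
  by simp

lemma word_empty: "word xs {} = 0\<^sub>v (length xs)"
  by (intro eq_vecI) auto

lemma word_sym_diff: "word xs (sym_diff B D) = word xs B + word xs D"
  by (intro eq_vecI) auto

lemma word_append: "word (xs @ ys) B = word xs B @\<^sub>v word ys B"
  by (intro eq_vecI) (auto simp: nth_append)

lemma word_cong:
  assumes "B \<inter> set xs = D \<inter> set xs"
  shows "word xs B = word xs D"
proof (intro eq_vecI)
  fix i assume "i < dim_vec (word xs D)"
  then have i: "i < length xs" by simp
  then have "xs ! i \<in> B \<longleftrightarrow> xs ! i \<in> D" using assms nth_mem by blast
  then show "word xs B $ i = word xs D $ i" using i by simp
qed simp

lemma scalar_prod_bit:
  fixes u v :: "bit vec"
  assumes "u \<in> carrier_vec n" "v \<in> carrier_vec n"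
  shows "u \<bullet> v = 0 \<longleftrightarrow> even (card (supp u \<inter> supp v))"
proof -
  have mult: "u $ i * v $ i = of_bool (i \<in> supp u \<inter> supp v)" if "i < n" for i
    using assms that by (cases "u $ i"; cases "v $ i") (auto simp: supp_def)
  have "u \<bullet> v = (\<Sum>i\<in>{0..<n}. of_bool (i \<in> supp u \<inter> supp v))"
    unfolding scalar_prod_def using assms mult by (intro sum.cong) auto
  also have "\<dots> = (\<Sum>i\<in>supp u \<inter> supp v. 1)"
    using supp_subset[OF assms(1)] by (intro sum.mono_neutral_cong_right) auto
  also have "\<dots> = of_nat (card (supp u \<inter> supp v))"
    by simp
  also have "\<dots> = 0 \<longleftrightarrow> even (card (supp u \<inter> supp v))"
    using even_of_nat_iff[of "card (supp u \<inter> supp v)", where ?'a = bit]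
    by (cases "of_nat (card (supp u \<inter> supp v)) :: bit") auto
  finally show ?thesis .
qed

text \<open>The binary span in terms of supports. With only the scalars 0 and 1, sums suffice, and
  adding one generator at a time gives a convenient induction.\<close>

inductive_set gen :: "nat set set \<Rightarrow> nat set set" for T where
  gen_empty: "{} \<in> gen T"
| gen_step: "B \<in> T \<Longrightarrow> D \<in> gen T \<Longrightarrow> sym_diff B D \<in> gen T"

lemma gen_base: "B \<in> T \<Longrightarrow> B \<in> gen T"
  using gen_step[OF _ gen_empty] by force

lemma gen_sym_diff: "D \<in> gen T \<Longrightarrow> E \<in> gen T \<Longrightarrow> sym_diff D E \<in> gen T"
proof (induction rule: gen.induct)
  case (gen_step B D)
  have "sym_diff (sym_diff B D) E = sym_diff B (sym_diff D E)" by blast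
  then show ?case using gen_step gen.gen_step by simp
qed simp

lemma gen_mono: "D \<in> gen T \<Longrightarrow> T \<subseteq> T' \<Longrightarrow> D \<in> gen T'"
  by (induction rule: gen.induct) (auto intro: gen.intros)

lemma gen_subset: "D \<in> gen T \<Longrightarrow> (\<And>B. B \<in> T \<Longrightarrow> B \<subseteq> X) \<Longrightarrow> D \<subseteq> X"
  by (induction rule: gen.induct) auto

text \<open>Images commute with symmetric differences when the map is injective on a set containing
  everything involved. This carries the span of a standard code to the place where its copy
  sits.\<close>

lemma gen_image:
  assumes f: "inj_on f X" and X: "\<And>B. B \<in> T \<Longrightarrow> B \<subseteq> X"
  shows "gen ((`) f ` T) = (`) f ` gen T"
proof -
  have sd: "f ` sym_diff B D = sym_diff (f ` B) (f ` D)" if "B \<subseteq> X" "D \<subseteq> X" for B D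
    using that f by (auto simp: inj_on_def; blast)
  have "E \<in> gen ((`) f ` T) \<Longrightarrow> E \<in> (`) f ` gen T" for E
  proof (induction rule: gen.induct)
    case (gen_step B D)
    then obtain B' D' where *: "B = f ` B'" "B' \<in> T" "D = f ` D'" "D' \<in> gen T" by auto
    then have "sym_diff B D = f ` sym_diff B' D'"
      using X gen_subset[of D' T X] by (simp add: sd)
    then show ?case using * by (auto intro: gen.intros)
  qed (auto intro: gen.intros)
  moreover have "f ` D \<in> gen ((`) f ` T)" if "D \<in> gen T" for D
    using that
  proof (induction rule: gen.induct)
    case (gen_step B D)
    then have "f ` sym_diff B D = sym_diff (f ` B) (f ` D)"
      using X gen_subset[of D T X] by (simp add: sd)
    then show ?case using gen_step by (auto intro: gen.intros)
  qed (auto intro: gen.intros)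
  ultimately show ?thesis by blast
qed

lemma tetrad_subcode_gen:
  assumes "tetrads C \<subseteq> carrier_vec n"
  shows "tetrad_subcode n C \<subseteq> carrier_vec n"
    and "supp ` tetrad_subcode n C = gen (supp ` tetrads C)"
proof -
  interpret V: vec_space "TYPE(bit)" n .
  have smult: "c \<cdot>\<^sub>v v = (if c = 0 then 0\<^sub>v n else v)" if "v \<in> carrier_vec n" for c :: bit and v
    using that by (cases c) auto
  let ?G = "{c \<in> carrier_vec n. supp c \<in> gen (supp ` tetrads C)}"
  \<comment> \<open>The span is the least submodule containing the tetrads, and the words with
    support in \<open>gen\<close> form such a submodule.\<close>
  have "V.span (tetrads C) \<subseteq> ?G"
  proof (rule V.span_is_subset)
    show "tetrads C \<subseteq> ?G" using assms by (auto intro: gen_base)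
    show "submodule class_ring ?G V.V"
      by (rule submodule.intro)
        (use V.module_axioms in \<open>auto simp: module_vec_simps supp_add gen_sym_diff gen_empty smult
          simp del: add_bit_eq_xor mult_bit_eq_and\<close>)
  qed
  moreover have "D \<in> supp ` V.span (tetrads C)" if "D \<in> gen (supp ` tetrads C)" for D
    using that
  proof (induction rule: gen.induct)
    case gen_empty
    have "0\<^sub>v n \<in> V.span (tetrads C)" using V.span_zero by simp
    then show ?case by (metis image_eqI supp_zero)
  next
    case (gen_step B D)
    then obtain b d where *: "b \<in> tetrads C" "B = supp b" "d \<in> V.span (tetrads C)" "D = supp d"
      by blast
    then have "b \<in> V.span (tetrads C)" using assms V.in_own_span by blast
    then have "b + d \<in> V.span (tetrads C)" using * assms V.span_add1 by simp
    moreover have "supp (b + d) = sym_diff B D"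
      using * assms V.span_closed by (subst supp_add) auto
    ultimately show ?case by (metis image_eqI)
  qed
  ultimately show "tetrad_subcode n C \<subseteq> carrier_vec n"
    and "supp ` tetrad_subcode n C = gen (supp ` tetrads C)"
    unfolding tetrad_subcode_def by auto
qed

section \<open>Direct sums of components\<close>

lemma gen_union:
  assumes "D \<in> gen S" "E \<in> gen T"
    and "\<And>B. B \<in> S \<Longrightarrow> B \<subseteq> X" "\<And>B. B \<in> T \<Longrightarrow> B \<subseteq> Y" "X \<inter> Y = {}"
  shows "D \<union> E \<in> gen (S \<union> T)"
proof -
  have "D \<subseteq> X" "E \<subseteq> Y" using gen_subset assms by metis+
  then have "D \<union> E = sym_diff D E" using assms by auto
  then show ?thesis using gen_sym_diff[of D "S \<union> T" E] gen_mono assms by (metis Un_upper1 Un_upper2)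
qed

lemma gen_unionE:
  "D \<in> gen (S \<union> T) \<Longrightarrow> \<exists>E\<in>gen S. \<exists>F\<in>gen T. D = sym_diff E F"
proof (induction rule: gen.induct)
  case gen_empty
  show ?case by (intro bexI[of _ "{}"]) (auto intro: gen.gen_empty)
next
  case (gen_step B D)
  then obtain E F where *: "E \<in> gen S" "F \<in> gen T" "D = sym_diff E F" by blast
  show ?case
  proof (cases "B \<in> S")
    case True
    have "sym_diff B D = sym_diff (sym_diff B E) F" using * by blast
    then show ?thesis using gen.gen_step[OF True *(1)] *(2) by metis
  next
    case False
    then have "B \<in> T" using gen_step by blast
    have "sym_diff B D = sym_diff E (sym_diff B F)" using * by blast
    then show ?thesis using gen.gen_step[OF \<open>B \<in> T\<close> *(2)] *(1) by metis
  qed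
qed

text \<open>Over disjoint coordinate sets a sum of two span members is their union, and each half of
  the word sees only its own summand.\<close>

lemma code_sum_gen:
  assumes S: "\<And>B. B \<in> S \<Longrightarrow> B \<subseteq> set xs" and T: "\<And>B. B \<in> T \<Longrightarrow> B \<subseteq> set ys"
    and disj: "set xs \<inter> set ys = {}"
  shows "word (xs @ ys) ` gen (S \<union> T) = code_sum (word xs ` gen S) (word ys ` gen T)"
proof -
  have app: "word (xs @ ys) D = word xs E @\<^sub>v word ys F"
    if "D = E \<union> F" "E \<in> gen S" "F \<in> gen T" for D E F
  proof -
    have "E \<subseteq> set xs" "F \<subseteq> set ys" using gen_subset that S T by metis+
    then have "D \<inter> set xs = E \<inter> set xs" "D \<inter> set ys = F \<inter> set ys" using that(1) disj by blast+
    then show ?thesis unfolding word_append using word_cong by metis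
  qed
  have "word (xs @ ys) D \<in> code_sum (word xs ` gen S) (word ys ` gen T)"
    if D: "D \<in> gen (S \<union> T)" for D
  proof -
    obtain E F where *: "E \<in> gen S" "F \<in> gen T" "D = sym_diff E F"
      using gen_unionE[OF D] by blast
    moreover have "E \<subseteq> set xs" "F \<subseteq> set ys" using gen_subset * S T by metis+
    ultimately have "D = E \<union> F" using disj by auto
    then show ?thesis using app[OF _ *(1,2)] * unfolding code_sum_def by blast
  qed
  moreover have "w \<in> word (xs @ ys) ` gen (S \<union> T)"
    if w: "w \<in> code_sum (word xs ` gen S) (word ys ` gen T)" for w
  proof -
    obtain E F where *: "E \<in> gen S" "F \<in> gen T" "w = word xs E @\<^sub>v word ys F"
      using w unfolding code_sum_def by auto
    then have "w = word (xs @ ys) (E \<union> F)" using app[OF refl] by simp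
    then show ?thesis using gen_union[OF *(1,2) S T disj] by blast
  qed
  ultimately show ?thesis by blast
qed

text \<open>A list rather than a set, because its order must match the coordinate order of the
  standard code \<open>A\<close>. The condition that no generator straddles the boundary is what
  makes the span split as a direct sum.\<close>

definition component :: "nat set set \<Rightarrow> bit vec set \<Rightarrow> nat list \<Rightarrow> bool" where
  "component T A xs \<longleftrightarrow> distinct xs \<and> (\<forall>B\<in>T. B \<inter> set xs \<noteq> {} \<longrightarrow> B \<subseteq> set xs)
     \<and> A = word xs ` gen {B \<in> T. B \<subseteq> set xs}"

lemma code_sum_components:
  assumes "\<forall>(A, xs)\<in>set L. component T A xs" "distinct (concat (map snd L))" "{} \<notin> T"
  shows "code_sum_list (map fst L) =
    word (concat (map snd L)) ` gen {B \<in> T. B \<subseteq> set (concat (map snd L))}"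
  using assms
proof (induction L)
  case Nil
  then have none: "{B \<in> T. B \<subseteq> set (concat (map snd []))} = {}" by auto
  moreover have "gen {} = {{}}"
  proof -
    have "D \<in> gen {} \<Longrightarrow> D = {}" for D by (induction rule: gen.induct) auto
    then show ?thesis using gen_empty by auto
  qed
  moreover have "vNil = word [] {}" by auto
  ultimately show ?case unfolding none by (simp add: code_sum_list_def)
next
  case (Cons p L)
  obtain A xs where p: "p = (A, xs)" by (cases p)
  let ?ys = "concat (map snd L)"
  have comp: "component T A xs" using Cons p by simp
  have disj: "set xs \<inter> set ?ys = {}" using Cons p by auto
  have IH: "code_sum_list (map fst L) = word ?ys ` gen {B \<in> T. B \<subseteq> set ?ys}"
    using Cons by simp
  have split: "{B \<in> T. B \<subseteq> set (xs @ ?ys)} = {B \<in> T. B \<subseteq> set xs} \<union> {B \<in> T. B \<subseteq> set ?ys}"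
  proof -
    have "B \<subseteq> set xs \<or> B \<subseteq> set ?ys" if "B \<in> T" "B \<subseteq> set (xs @ ?ys)" for B
    proof (cases "B \<inter> set xs = {}")
      case True
      then show ?thesis using that(2) unfolding set_append by blast
    next
      case False
      then show ?thesis using comp that(1) unfolding component_def by blast
    qed
    then show ?thesis unfolding set_append by blast
  qed
  have "code_sum_list (map fst (p # L)) = code_sum A (code_sum_list (map fst L))"
    using p by (simp add: code_sum_list_def)
  also have "\<dots> = code_sum (word xs ` gen {B \<in> T. B \<subseteq> set xs}) (word ?ys ` gen {B \<in> T. B \<subseteq> set ?ys})"
    using comp IH unfolding component_def by simp
  also have "\<dots> = word (xs @ ?ys) ` gen {B \<in> T. B \<subseteq> set (xs @ ?ys)}"
    unfolding split by (rule code_sum_gen[symmetric]) (use disj in auto)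
  finally show ?case using p by simp
qed

lemma has_tetrad_systemI:
  assumes C: "tetrads C \<subseteq> carrier_vec n"
    and L: "\<forall>(A, xs)\<in>set L. component (supp ` tetrads C) A xs"
    and xs: "distinct (concat (map snd L))" "set (concat (map snd L)) = {..<n}"
  shows "has_tetrad_system n C (map fst L)"
proof -
  define xs where "xs = concat (map snd L)"
  \<comment> \<open>Position \<open>i\<close> is sent to the coordinate listed there, so permuting a
    word means reading it along \<open>xs\<close>; outside the range \<open>permutes\<close> demands
    the identity.\<close>
  define p where "p i = (if i < n then xs ! i else i)" for i
  have len: "length xs = n" using xs distinct_card[of xs] unfolding xs_def by simp
  have "bij_betw p {..<n} {..<n}"
  proof -
    have "bij_betw ((!) xs) {..<length xs} (set xs)"
      by (rule bij_betw_nth) (use xs(1) in \<open>simp_all add: xs_def\<close>)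
    then have "bij_betw ((!) xs) {..<n} {..<n}"
      using len xs(2) unfolding xs_def[symmetric] by simp
    then show ?thesis
      by (rule bij_betw_cong[THEN iffD1, rotated]) (simp add: p_def)
  qed
  then have "p permutes {..<n}" by (rule bij_imp_permutes) (auto simp: p_def)
  moreover have "permute_word p ` tetrad_subcode n C = code_sum_list (map fst L)"
  proof -
    have perm: "permute_word p c = word xs (supp c)" if "c \<in> carrier_vec n" for c
    proof (intro eq_vecI)
      fix i assume "i < dim_vec (word xs (supp c))"
      then have i: "i < n" by (simp add: len)
      then have "xs ! i < n" using xs len nth_mem[of i xs] unfolding xs_def[symmetric] by auto
      then show "permute_word p c $ i = word xs (supp c) $ i"
        using that i by (cases "c $ (xs ! i)") (simp_all add: permute_word_def p_def supp_def len)
    qed (use that len in \<open>auto simp: permute_word_def\<close>)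
    have T: "{B \<in> supp ` tetrads C. B \<subseteq> set xs} = supp ` tetrads C"
      using C xs supp_subset unfolding xs_def[symmetric] by blast
    have "{} \<notin> supp ` tetrads C" by (auto simp: tetrads_def wt_eq_card_supp)
    then have "code_sum_list (map fst L) = word xs ` gen (supp ` tetrads C)"
      using code_sum_components[OF L xs(1)] T unfolding xs_def by simp
    also have "\<dots> = word xs ` supp ` tetrad_subcode n C"
      using tetrad_subcode_gen[OF C] by simp
    also have "\<dots> = permute_word p ` tetrad_subcode n C"
      unfolding image_image using perm tetrad_subcode_gen(1)[OF C] by (intro image_cong) auto
    finally show ?thesis by simp
  qed
  ultimately show ?thesis unfolding has_tetrad_system_def by blast
qed

section \<open>Equidistribution of tetrads\<close>

text \<open>The character (-1)^(c_i) of the word with support \<open>B\<close>, with integer values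
  so that moments can be formed.\<close>

definition sgn_at :: "nat \<Rightarrow> nat set \<Rightarrow> int" where
  "sgn_at i B = (if i \<in> B then -1 else 1)"

lemma sgn_at_sym_diff: "sgn_at i (sym_diff B D) = sgn_at i B * sgn_at i D"
  by (auto simp: sgn_at_def)

lemma sgn_at_square [simp]: "sgn_at i B * sgn_at i B = 1" "sgn_at i B * (sgn_at i B * x) = x"
  by (simp_all add: sgn_at_def)

lemma sum_sgn_at:
  assumes "B \<subseteq> {..<n}"
  shows "(\<Sum>j<n. sgn_at j B) = int n - 2 * int (card B)"
proof -
  have "(\<Sum>j<n. sgn_at j B) = (\<Sum>j<n. 1 - 2 * of_bool (j \<in> B))"
    by (intro sum.cong) (auto simp: sgn_at_def)
  also have "\<dots> = int n - 2 * (\<Sum>j<n. of_bool (j \<in> B))"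
    by (simp add: sum_subtractf sum_distrib_left)
  also have "(\<Sum>j<n. of_bool (j \<in> B)) = int (card ({..<n} \<inter> B))"
    by simp
  finally show ?thesis using assms by (simp add: Int_absorb1)
qed

lemma prod_sgn_at:
  assumes "finite A"
  shows "(\<Prod>j\<in>A. sgn_at j B) = (if even (card (A \<inter> B)) then 1 else -1)"
  using assms
proof (induction A)
  case (insert x A)
  then show ?case by (auto simp: sgn_at_def Int_insert_left)
qed simp

text \<open>If some member has value -1, translation by it permutes the summands and negates their
  sum, which is therefore 0.\<close>

lemma character_sum:
  fixes h :: "nat set \<Rightarrow> int"
  assumes closed: "\<And>B D. B \<in> F \<Longrightarrow> D \<in> F \<Longrightarrow> sym_diff B D \<in> F"
    and mult: "\<And>B D. h (sym_diff B D) = h B * h D"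
    and sgn: "\<And>B. h B = 1 \<or> h B = -1"
  shows "(\<Sum>B\<in>F. h B) = int (card F) * of_bool (\<forall>B\<in>F. h B = 1)"
proof (cases "\<forall>B\<in>F. h B = 1")
  case True
  then have "(\<Sum>B\<in>F. h B) = (\<Sum>B\<in>F. 1)" by (intro sum.cong) auto
  with True show ?thesis by simp
next
  case False
  then obtain D where D: "D \<in> F" "h D = -1" using sgn by blast
  have inv: "sym_diff (sym_diff B D) D = B" for B by blast
  have "(\<Sum>B\<in>F. h B) = (\<Sum>B\<in>F. h (sym_diff B D))"
    by (rule sum.reindex_bij_witness[where i = "\<lambda>B. sym_diff B D" and j = "\<lambda>B. sym_diff B D"])
      (use closed D inv in auto)
  also have "\<dots> = - (\<Sum>B\<in>F. h B)"
    by (simp only: mult D(2)) (simp add: sum_negf)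
  finally show ?thesis using False by simp
qed

lemma sum_triple:
  "(\<Sum>j\<in>A. \<Sum>k\<in>B. \<Sum>l\<in>C. g j k l) = (\<Sum>(j, k, l)\<in>A \<times> B \<times> C. g j k l)"
proof -
  have "(\<Sum>j\<in>A. \<Sum>k\<in>B. \<Sum>l\<in>C. g j k l) = (\<Sum>j\<in>A. \<Sum>(k, l)\<in>B \<times> C. g j k l)"
    by (intro sum.cong refl sum.cartesian_product)
  also have "\<dots> = (\<Sum>(j, k, l)\<in>A \<times> B \<times> C. g j k l)"
    by (rule sum.cartesian_product)
  finally show ?thesis .
qed

text \<open>The three points other than \<open>i\<close> can be ordered in 3! ways; this is the
  factor 6 in the third moment.\<close>

lemma card_tuples_of_tetrad:
  assumes "card Q = 4" "i \<in> Q"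
  shows "card {(j, k, l). distinct [i, j, k, l] \<and> {i, j, k, l} = Q} = 6"
proof -
  have "card (Q - {i}) = 3" using assms by simp
  then obtain p q s where pqs: "Q - {i} = {p, q, s}" "p \<noteq> q" "q \<noteq> s" "p \<noteq> s"
    unfolding card_3_iff by auto
  then have i: "i \<noteq> p" "i \<noteq> q" "i \<noteq> s" by auto
  have Q: "Q = {i, p, q, s}" using pqs assms by blast
  have "{(j, k, l). distinct [i, j, k, l] \<and> {i, j, k, l} = Q}
      = {(p,q,s), (p,s,q), (q,p,s), (q,s,p), (s,p,q), (s,q,p)}" (is "?L = ?R")
  proof
    show "?R \<subseteq> ?L" unfolding Q using pqs i by auto
    show "?L \<subseteq> ?R"
    proof
      fix x assume "x \<in> ?L"
      then obtain j k l where x: "x = (j, k, l)" and d: "distinct [i, j, k, l]" and e: "{i, j, k, l} = Q"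
        by blast
      then have "{j, k, l} = {p, q, s}" using pqs(1) by auto
      then have "j = p \<or> j = q \<or> j = s" "k = p \<or> k = q \<or> k = s" "l = p \<or> l = q \<or> l = s" by blast+
      then show "x \<in> ?R" using d x by auto
    qed
  qed
  then show ?thesis using pqs by simp
qed

text \<open>A Type II code seen through its supports: scalar products become parities of
  intersections, and \<open>inter\<close> and \<open>dual\<close> are the two inclusions of
  self-duality.\<close>

locale type_II_sets =
  fixes n :: nat and F :: "nat set set"
  assumes sub: "B \<in> F \<Longrightarrow> B \<subseteq> {..<n}"
    and closed: "B \<in> F \<Longrightarrow> D \<in> F \<Longrightarrow> sym_diff B D \<in> F"
    and inter: "B \<in> F \<Longrightarrow> D \<in> F \<Longrightarrow> even (card (B \<inter> D))"
    and dual: "A \<subseteq> {..<n} \<Longrightarrow> (\<And>B. B \<in> F \<Longrightarrow> even (card (A \<inter> B))) \<Longrightarrow> A \<in> F"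
    and four: "B \<in> F \<Longrightarrow> 4 dvd card B"
begin

definition quads :: "nat set set" where
  "quads = {B \<in> F. card B = 4}"

definition quads_at :: "nat \<Rightarrow> nat set set" where
  "quads_at i = {B \<in> quads. i \<in> B}"

lemma finite_F: "finite F"
  using finite_subset[of F "Pow {..<n}"] sub by auto

lemma finite_quads: "finite quads" "finite (quads_at i)"
  using finite_F by (auto simp: quads_def quads_at_def)

lemma finite_mem: "B \<in> F \<Longrightarrow> finite B"
  using sub finite_subset by blast

lemma empty_F: "{} \<in> F"
  by (rule dual) auto

lemma UNIV_F: "{..<n} \<in> F"
proof (rule dual)
  fix B assume "B \<in> F"
  then have "{..<n} \<inter> B = B" "4 dvd card B" using sub four by auto
  then show "even (card ({..<n} \<inter> B))" using dvd_trans[of 2 4] by force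
qed auto

lemma compl_F: "B \<in> F \<Longrightarrow> {..<n} - B \<in> F"
  using closed[OF UNIV_F, of B] sub[of B] by (simp add: Un_absorb2 Diff_eq_empty_iff[THEN iffD2])

lemma sum_sgn2:
  assumes "i < n" "j < n"
  shows "(\<Sum>B\<in>F. sgn_at i B * sgn_at j B) = int (card F) * of_bool (i = j)"
proof -
  have "(\<forall>B\<in>F. sgn_at i B * sgn_at j B = 1) \<longleftrightarrow> i = j"
  proof
    assume *: "\<forall>B\<in>F. sgn_at i B * sgn_at j B = 1"
    show "i = j"
    proof (rule ccontr)
      assume "i \<noteq> j"
      \<comment> \<open>A product of two signs that is trivial on the code would make the pair
        orthogonal to the code, hence a codeword of weight 2.\<close>
      have "{i, j} \<in> F"
      proof (rule dual)
        fix B assume "B \<in> F"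
        then have "(\<Prod>u\<in>{i, j}. sgn_at u B) = 1" using * \<open>i \<noteq> j\<close> by simp
        then show "even (card ({i, j} \<inter> B))" by (subst (asm) prod_sgn_at) (auto split: if_splits)
      qed (use assms in auto)
      then have "4 dvd card {i, j}" by (rule four)
      moreover have "card {i, j} = 2" using \<open>i \<noteq> j\<close> by simp
      ultimately show False by simp
    qed
  qed simp
  moreover have "(\<Sum>B\<in>F. sgn_at i B * sgn_at j B)
      = int (card F) * of_bool (\<forall>B\<in>F. sgn_at i B * sgn_at j B = 1)"
  proof (rule character_sum)
    show "sgn_at i (sym_diff B D) * sgn_at j (sym_diff B D)
        = sgn_at i B * sgn_at j B * (sgn_at i D * sgn_at j D)" for B D
      unfolding sgn_at_sym_diff by (simp only: ac_simps)
  qed (use closed in \<open>auto simp: sgn_at_def\<close>)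
  ultimately show ?thesis by simp
qed

text \<open>For distinct indices the product is a character, trivial exactly when the four indices
  form a codeword, by \<open>dual\<close> and \<open>inter\<close>. Otherwise two equal signs cancel
  and \<open>sum_sgn2\<close> evaluates the rest.\<close>

lemma sum_sgn4:
  assumes "i < n" "j < n" "k < n" "l < n"
  shows "(\<Sum>B\<in>F. sgn_at i B * (sgn_at j B * (sgn_at k B * sgn_at l B))) = int (card F) *
    (of_bool (i = j \<and> k = l \<or> i = k \<and> j = l \<or> i = l \<and> j = k)
      + of_bool (distinct [i, j, k, l] \<and> {i, j, k, l} \<in> F))"
proof (cases "distinct [i, j, k, l]")
  case True
  let ?h = "\<lambda>B. sgn_at i B * (sgn_at j B * (sgn_at k B * sgn_at l B))"
  have h: "?h B = (if even (card ({i, j, k, l} \<inter> B)) then 1 else -1)" for B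
    using prod_sgn_at[of "{i, j, k, l}" B] True by simp
  have "(\<forall>B\<in>F. ?h B = 1) \<longleftrightarrow> {i, j, k, l} \<in> F"
    unfolding h using dual[of "{i, j, k, l}"] inter assms by auto
  moreover have "(\<Sum>B\<in>F. ?h B) = int (card F) * of_bool (\<forall>B\<in>F. ?h B = 1)"
  proof (rule character_sum)
    show "?h B = 1 \<or> ?h B = -1" for B unfolding h by simp
    show "?h (sym_diff B D) = ?h B * ?h D" for B D
      unfolding sgn_at_sym_diff by (simp only: ac_simps)
  qed (use closed in auto)
  ultimately show ?thesis using True by simp
next
  case False
  then consider "i = j" | "i = k" | "i = l" | "j = k" | "j = l" | "k = l" by auto
  then show ?thesis
  proof cases
    case 1
    with sum_sgn2[of k l] assms show ?thesis by auto
  next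
    case 2
    with sum_sgn2[of j l] assms show ?thesis by (auto simp: mult.left_commute[of "sgn_at j _"])
  next
    case 3
    with sum_sgn2[of j k] assms show ?thesis
      by (auto simp: mult.left_commute[of "sgn_at j _"] mult.commute[of "sgn_at k _" "sgn_at l _"])
  next
    case 4
    with sum_sgn2[of i l] assms show ?thesis by auto
  next
    case 5
    with sum_sgn2[of i k] assms show ?thesis by (auto simp: mult.commute[of "sgn_at k _" "sgn_at l _"])
  next
    case 6
    with sum_sgn2[of i j] assms show ?thesis by auto
  qed
qed

text \<open>Each of the three pairings leaves \<open>n\<close> choices, and any two pairings
  together force all indices to be equal, so inclusion-exclusion gives 3n - 3 + 1. The proof sums
  over \<open>l\<close> first.\<close>

lemma sum_coincidences:
  fixes i :: nat
  assumes "i < n"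
  shows "(\<Sum>j<n. \<Sum>k<n. \<Sum>l<n. of_bool (i = j \<and> k = l \<or> i = k \<and> j = l \<or> i = l \<and> j = k) :: int)
     = 3 * int n - 2"
proof -
  have inner: "(\<Sum>l<n. of_bool (i = j \<and> k = l \<or> i = k \<and> j = l \<or> i = l \<and> j = k) :: int)
     = of_bool (j = i) + of_bool (j \<noteq> i) * (of_bool (k = i) + of_bool (k = j))"
    if "j < n" "k < n" for j k
  proof -
    let ?c = "\<lambda>l. i = j \<and> k = l \<or> i = k \<and> j = l \<or> i = l \<and> j = k"
    have delta: "(\<Sum>l<n. of_bool (m = l) :: int) = 1" if "m < n" for m
      using that by (simp add: of_bool_def)
    consider "j = i" | "j \<noteq> i" "k = i" | "j \<noteq> i" "k \<noteq> i" "k = j" | "j \<noteq> i" "k \<noteq> i" "k \<noteq> j" by blast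
    then show ?thesis
    proof cases
      case 1
      then have "?c l \<longleftrightarrow> k = l" for l by auto
      with 1 show ?thesis using delta that by simp
    next
      case 2
      then have "?c l \<longleftrightarrow> j = l" for l by auto
      with 2 show ?thesis using delta that by simp
    next
      case 3
      then have "?c l \<longleftrightarrow> i = l" for l by auto
      with 3 show ?thesis using delta assms by simp
    next
      case 4
      then have "\<not> ?c l" for l by auto
      with 4 show ?thesis by simp
    qed
  qed
  have "(\<Sum>j<n. \<Sum>k<n. \<Sum>l<n. of_bool (i = j \<and> k = l \<or> i = k \<and> j = l \<or> i = l \<and> j = k) :: int)
     = (\<Sum>j<n. \<Sum>k<n. of_bool (j = i) + of_bool (j \<noteq> i) * (of_bool (k = i) + of_bool (k = j)))"
    by (intro sum.cong refl inner) auto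
  also have "\<dots> = (\<Sum>j<n. (if j = i then int n - 2 else 0) + 2)"
  proof (intro sum.cong refl)
    fix j assume "j \<in> {..<n}"
    moreover have delta: "(\<Sum>k<n. of_bool (k = m) :: int) = 1" if "m < n" for m
      using that by (simp add: of_bool_def)
    ultimately show "(\<Sum>k<n. of_bool (j = i) + of_bool (j \<noteq> i) * (of_bool (k = i) + of_bool (k = j)))
        = (if j = i then int n - 2 else 0) + 2"
      using assms by (cases "j = i") (simp_all add: sum.distrib)
  qed
  also have "\<dots> = 3 * int n - 2"
    using assms by (simp add: sum.distrib)
  finally show ?thesis .
qed

lemma sum_quads_at:
  assumes "i < n"
  shows "(\<Sum>j<n. \<Sum>k<n. \<Sum>l<n. of_bool (distinct [i, j, k, l] \<and> {i, j, k, l} \<in> F) :: int)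
     = 6 * int (card (quads_at i))"
proof -
  let ?P = "\<lambda>(j, k, l). distinct [i, j, k, l] \<and> {i, j, k, l} \<in> F"
  let ?t = "\<lambda>Q. {(j, k, l). distinct [i, j, k, l] \<and> {i, j, k, l} = Q}"
  have fin: "finite ({..<n} \<times> {..<n} \<times> {..<n})" by simp
  have "(\<Sum>j<n. \<Sum>k<n. \<Sum>l<n. of_bool (distinct [i, j, k, l] \<and> {i, j, k, l} \<in> F) :: int)
    = (\<Sum>x\<in>{..<n} \<times> {..<n} \<times> {..<n}. of_bool (?P x))"
    unfolding sum_triple by (simp only: case_prod_unfold)
  also have "\<dots> = int (card (({..<n} \<times> {..<n} \<times> {..<n}) \<inter> {x. ?P x}))"
    using fin by (simp only: sum_of_bool_eq)
  also have "({..<n} \<times> {..<n} \<times> {..<n}) \<inter> {x. ?P x} = (\<Union>Q\<in>quads_at i. ?t Q)"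
  proof -
    have "{i, j, k, l} \<in> quads_at i" "j < n" "k < n" "l < n"
      if "distinct [i, j, k, l]" "{i, j, k, l} \<in> F" for j k l
      using that sub[of "{i, j, k, l}"] by (auto simp: quads_at_def quads_def)
    then show ?thesis
      by (auto simp: quads_at_def quads_def)
  qed
  also have "card \<dots> = (\<Sum>Q\<in>quads_at i. card (?t Q))"
  proof (rule card_UN_disjoint)
    show "finite (quads_at i)" by (rule finite_quads)
    have "?t Q \<subseteq> {..<n} \<times> {..<n} \<times> {..<n}" if "Q \<in> quads_at i" for Q
      using that sub[of Q] by (auto simp: quads_at_def quads_def)
    then show "\<forall>Q\<in>quads_at i. finite (?t Q)" using fin finite_subset by blast
  qed auto
  also have "\<dots> = (\<Sum>Q\<in>quads_at i. 6)"
    by (intro sum.cong refl card_tuples_of_tetrad) (auto simp: quads_at_def quads_def)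
  finally show ?thesis by simp
qed

lemma sum_first_moment:
  assumes "i < n"
  shows "(\<Sum>B\<in>F. sgn_at i B * (\<Sum>j<n. sgn_at j B)) = int (card F)"
proof -
  have "(\<Sum>B\<in>F. sgn_at i B * (\<Sum>j<n. sgn_at j B)) = (\<Sum>j<n. \<Sum>B\<in>F. sgn_at i B * sgn_at j B)"
    unfolding sum_distrib_left by (rule sum.swap)
  also have "\<dots> = (\<Sum>j<n. int (card F) * of_bool (i = j))"
    using assms by (intro sum.cong) (auto simp: sum_sgn2)
  also have "\<dots> = int (card F)"
    using assms by (simp flip: sum_distrib_left)
  finally show ?thesis .
qed

text \<open>Expanding the cube and exchanging the sums reduces everything to
  \<open>sum_sgn4\<close>: coincidences account for 3n - 2 triples, and every tetrad through
  \<open>i\<close> for six more.\<close>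

lemma sum_third_moment:
  assumes "i < n"
  shows "(\<Sum>B\<in>F. sgn_at i B * (\<Sum>j<n. sgn_at j B) ^ 3)
    = int (card F) * (3 * int n - 2 + 6 * int (card (quads_at i)))"
proof -
  have cube: "x * (\<Sum>j<n. f j) ^ 3 = (\<Sum>j<n. \<Sum>k<n. \<Sum>l<n. x * (f j * (f k * f l)))"
    for x :: int and f :: "nat \<Rightarrow> int"
    by (simp add: power3_eq_cube mult.assoc sum_distrib_right sum_distrib_left)
      (simp flip: sum_distrib_right sum_distrib_left)
  have "(\<Sum>B\<in>F. sgn_at i B * (\<Sum>j<n. sgn_at j B) ^ 3)
     = (\<Sum>j<n. \<Sum>k<n. \<Sum>l<n. \<Sum>B\<in>F. sgn_at i B * (sgn_at j B * (sgn_at k B * sgn_at l B)))"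
    unfolding cube by (subst sum.swap, intro sum.cong refl, subst sum.swap, intro sum.cong refl, rule sum.swap)
  also have "\<dots> = (\<Sum>j<n. \<Sum>k<n. \<Sum>l<n. int (card F) *
    (of_bool (i = j \<and> k = l \<or> i = k \<and> j = l \<or> i = l \<and> j = k)
      + of_bool (distinct [i, j, k, l] \<and> {i, j, k, l} \<in> F)))"
    using assms by (intro sum.cong refl sum_sgn4) auto
  also have "\<dots> = int (card F) * (3 * int n - 2 + 6 * int (card (quads_at i)))"
    unfolding sum_coincidences[OF assms, symmetric] sum_quads_at[OF assms, symmetric]
    by (simp only: sum_distrib_left[symmetric] sum.distrib)
  finally show ?thesis .
qed

text \<open>The cubic \<open>s\<^sup>3 - 64 s\<close> vanishes at the values \<open>s = 24 - 2 w\<close> belonging to the weights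
  \<open>w = 8, 12, 16\<close>, so only words of weight 0, 4, 20 and 24 contribute to its sum.\<close>

lemma quads_at_equation:
  assumes n: "n = 24" and i: "i < n"
  shows "24576 + 6144 * (int (card quads) - 2 * int (card (quads_at i)))
    = int (card F) * (6 * int (card (quads_at i)) + 6)"
proof -
  define S where "S B = (\<Sum>j<n. sgn_at j B)" for B
  define g where "g B = sgn_at i B * (S B ^ 3 - 64 * S B)" for B
  let ?c = "\<lambda>B. {..<n} - B"
  have S: "S B = 24 - 2 * int (card B)" if "B \<in> F" for B
    unfolding S_def using sum_sgn_at[OF sub[OF that]] n by simp
  have card_c: "card (?c B) = 24 - card B" and card_le: "card B \<le> 24" if "B \<in> F" for B
    using sub[OF that] finite_mem[OF that] n card_mono[of "{..<n}" B] by (auto simp: card_Diff_subset)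
  \<comment> \<open>Complementation negates the sign at \<open>i\<close> and the odd cubic alike, so
    words of weight 20 and 24 repeat the contributions of weight 4 and 0.\<close>
  have g_c: "g (?c B) = g B" if "B \<in> F" for B
  proof -
    have "S (?c B) = - S B" using S[OF that] S[OF compl_F[OF that]] card_c[OF that] card_le[OF that] by simp
    moreover have "sgn_at i (?c B) = - sgn_at i B" using i by (simp add: sgn_at_def)
    ultimately show ?thesis by (simp add: g_def algebra_simps)
  qed
  have cc: "?c (?c B) = B" if "B \<in> F" for B using sub[OF that] by auto
  \<comment> \<open>Weight 4 gives s = 16 and 16^3 - 64 * 16 = 3072; weight 0 gives s = 24 and 24^3
    - 64 * 24 = 12288. Doubling for the complements yields 6144 and 24576.\<close>
  have g4: "g B = 3072 * sgn_at i B" if "B \<in> quads" for B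
    using that by (simp add: g_def S quads_def)
  have g0: "g {} = 12288" by (simp add: g_def S empty_F sgn_at_def)
  have rest: "g B = 0" if B: "B \<in> F" "B \<noteq> {}" "B \<noteq> {..<n}" "B \<notin> quads" "B \<notin> ?c ` quads" for B
  proof -
    have "card B \<noteq> 20"
    proof
      assume "card B = 20"
      then have "?c B \<in> quads" using B card_c compl_F by (simp add: quads_def)
      then show False using B cc by (metis image_eqI)
    qed
    moreover have "card B \<noteq> 0" using B finite_mem by auto
    moreover have "card B \<noteq> 24" using B sub n card_subset_eq[of "{..<n}" B] by auto
    moreover have "card B \<noteq> 4" using B by (simp add: quads_def)
    moreover obtain m where "card B = 4 * m" using four B by blast
    ultimately have "card B = 8 \<or> card B = 12 \<or> card B = 16" using card_le[OF B(1)] by presburger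
    then show ?thesis using S[OF B(1)] by (auto simp: g_def)
  qed
  have sum_c: "(\<Sum>B\<in>?c ` quads. g B) = (\<Sum>B\<in>quads. g B)"
  proof -
    have "inj_on ?c quads" by (rule inj_on_inverseI[of _ ?c]) (use cc in \<open>auto simp: quads_def\<close>)
    then show ?thesis using g_c by (auto simp: sum.reindex quads_def intro: sum.cong)
  qed
  have card_mem: "card B = 20" if "B \<in> ?c ` quads" for B
    using that card_c by (auto simp: quads_def)
  have "(\<Sum>B\<in>F. g B) = (\<Sum>B\<in>{{}, {..<n}} \<union> (quads \<union> ?c ` quads). g B)"
  proof (rule sum.mono_neutral_right)
    have "quads \<subseteq> F" by (auto simp: quads_def)
    then have "?c ` quads \<subseteq> F" using compl_F by blast
    with \<open>quads \<subseteq> F\<close> show "{{}, {..<n}} \<union> (quads \<union> ?c ` quads) \<subseteq> F"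
      using empty_F UNIV_F by simp
    show "\<forall>B\<in>F - ({{}, {..<n}} \<union> (quads \<union> ?c ` quads)). g B = 0"
      using rest by blast
  qed (rule finite_F)
  also have "\<dots> = (\<Sum>B\<in>{{}, {..<n}}. g B) + (\<Sum>B\<in>quads \<union> ?c ` quads. g B)"
  proof (rule sum.union_disjoint)
    have *: "card B \<in> {4, 20}" if "B \<in> quads \<union> ?c ` quads" for B
      using that card_mem unfolding quads_def by blast
    show "{{}, {..<n}} \<inter> (quads \<union> ?c ` quads) = {}"
    proof (rule equals0I)
      fix B assume B: "B \<in> {{}, {..<n}} \<inter> (quads \<union> ?c ` quads)"
      then have "card B = 0 \<or> card B = 24" using n by force
      moreover have "card B \<in> {4, 20}" using * B by blast
      ultimately show False by auto
    qed
  qed (use finite_quads in simp_all)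
  also have "(\<Sum>B\<in>{{}, {..<n}}. g B) = 24576"
  proof -
    have "card {..<n} \<noteq> card ({} :: nat set)" using n by simp
    then have "{} \<noteq> {..<n}" by metis
    then show ?thesis using g0 g_c[OF empty_F] by simp
  qed
  also have "(\<Sum>B\<in>quads \<union> ?c ` quads. g B) = (\<Sum>B\<in>quads. g B) + (\<Sum>B\<in>?c ` quads. g B)"
  proof (rule sum.union_disjoint)
    have "card B = 4" if "B \<in> quads" for B using that by (simp add: quads_def)
    moreover have "(4 :: nat) \<noteq> 20" by simp
    ultimately show "quads \<inter> ?c ` quads = {}" using card_mem by (metis disjoint_iff)
  qed (use finite_quads in simp_all)
  also have "\<dots> = 6144 * (\<Sum>B\<in>quads. sgn_at i B)"
    using g4 by (simp add: sum_c sum_distrib_left[symmetric])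
  also have "(\<Sum>B\<in>quads. sgn_at i B) = (\<Sum>B\<in>quads. 1 - 2 * of_bool (i \<in> B))"
    by (intro sum.cong) (auto simp: sgn_at_def)
  also have "\<dots> = int (card quads) - 2 * (\<Sum>B\<in>quads. of_bool (i \<in> B))"
    by (simp add: sum_subtractf sum_distrib_left)
  also have "(\<Sum>B\<in>quads. of_bool (i \<in> B)) = int (card (quads_at i))"
  proof -
    have "quads_at i = quads \<inter> {B. i \<in> B}" by (auto simp: quads_at_def)
    then show ?thesis using finite_quads(1) by simp
  qed
  finally have "(\<Sum>B\<in>F. g B) = 24576 + 6144 * (int (card quads) - 2 * int (card (quads_at i)))" .
  \<comment> \<open>The same sum by moments: for \<open>n\<close> = 24 the constant is 3 * 24 - 2 -
    64 = 6, whence the factor 6r + 6.\<close>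
  moreover have "(\<Sum>B\<in>F. g B)
      = (\<Sum>B\<in>F. sgn_at i B * S B ^ 3) - 64 * (\<Sum>B\<in>F. sgn_at i B * S B)"
    unfolding g_def by (simp add: sum_subtractf sum_distrib_left algebra_simps)
  ultimately show ?thesis
    unfolding S_def sum_first_moment[OF i] sum_third_moment[OF i] using n by (simp add: algebra_simps)
qed

lemma card_quads_at_eq:
  assumes "n = 24" "i < n" "j < n"
  shows "card (quads_at i) = card (quads_at j)"
proof -
  define x y N where "x = int (card (quads_at i))" "y = int (card (quads_at j))" "N = int (card F)"
  \<comment> \<open>Collecting the terms in the local count leaves a right side built only from
    \<open>card F\<close> and \<open>card quads\<close>, the same for both coordinates; the
    coefficient is positive.\<close>
  have "(12288 + 6 * N) * x = (12288 + 6 * N) * y"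
    using quads_at_equation[OF assms(1,2)] quads_at_equation[OF assms(1,3)]
    unfolding x_y_N_def by (simp add: algebra_simps)
  moreover have "12288 + 6 * N \<noteq> 0" by (simp add: x_y_N_def)
  ultimately show ?thesis unfolding mult_cancel_left x_y_N_def by simp
qed

end

section \<open>Generating the component codes by tetrads\<close>

text \<open>Beyond generation by \<open>D\<close>, the degree \<open>r\<close> is what gets compared
  with the ambient tetrad count. That any two coordinates share a generator confines a copy to the
  union of the tetrads through any one of its points.\<close>

definition code_model :: "bit vec set \<Rightarrow> nat \<Rightarrow> nat set set \<Rightarrow> nat \<Rightarrow> bool" where
  "code_model A n D r \<longleftrightarrow> A = word [0..<n] ` gen D \<and> (\<forall>S\<in>D. S \<subseteq> {..<n})
     \<and> (\<forall>i<n. card {S \<in> D. i \<in> S} = r) \<and> (\<forall>i<n. \<forall>j<n. \<exists>S\<in>D. i \<in> S \<and> j \<in> S)"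

section \<open>Words constant on consecutive pairs, and the codes \<open>d_code\<close>\<close>

definition pair_union :: "nat set \<Rightarrow> nat set" where
  "pair_union J = {m. m div 2 \<in> J}"

lemma pair_union_sym_diff: "pair_union (sym_diff I J) = sym_diff (pair_union I) (pair_union J)"
  by (auto simp: pair_union_def)

lemma pair_union_insert: "pair_union (insert i J) = {2 * i, 2 * i + 1} \<union> pair_union J"
  by (auto simp: pair_union_def)

lemma pair_union_empty [simp]: "pair_union {} = {}"
  by (simp add: pair_union_def)

lemma pair_union_subset: "J \<subseteq> {..<k} \<Longrightarrow> pair_union J \<subseteq> {..<2 * k}"
  by (auto simp: pair_union_def)

lemma finite_pair_union: "finite J \<Longrightarrow> finite (pair_union J)"
  by (induction J rule: finite_induct) (simp_all add: pair_union_insert)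

lemma card_pair_union: "finite J \<Longrightarrow> card (pair_union J) = 2 * card J"
proof (induction J rule: finite_induct)
  case (insert i J)
  have "card ({2 * i, 2 * i + 1} \<union> pair_union J) = card {2 * i, 2 * i + 1} + card (pair_union J)"
    using insert by (intro card_Un_disjoint) (auto simp: finite_pair_union, auto simp: pair_union_def)
  then show ?case using insert by (simp add: pair_union_insert)
qed simp

lemma even_card_sym_diff:
  assumes "finite A" "finite B"
  shows "even (card (sym_diff A B)) \<longleftrightarrow> even (card A + card B)"
proof -
  have "card (sym_diff A B) = card (A - B) + card (B - A)"
    using assms by (intro card_Un_disjoint) auto
  moreover have "card A = card (A - B) + card (A \<inter> B)"
    using assms by (metis card_Diff_subset_Int card_Int_Diff finite_Int add.commute)
  moreover have "card B = card (B - A) + card (A \<inter> B)"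
    using assms by (metis card_Int_Diff add.commute Int_commute)
  ultimately show ?thesis by presburger
qed

definition d_quads :: "nat \<Rightarrow> nat set set" where
  "d_quads k = {pair_union {i, j} |i j. i < k \<and> j < k \<and> i \<noteq> j}"

lemma d_quads_at:
  assumes "m < 2 * k"
  shows "{S \<in> d_quads k. m \<in> S} = (\<lambda>j. pair_union {m div 2, j}) ` ({..<k} - {m div 2})" (is "?L = ?R")
proof
  have "m div 2 < k" using assms by simp
  then show "?R \<subseteq> ?L" by (auto simp: d_quads_def pair_union_def)
  show "?L \<subseteq> ?R"
  proof
    fix S assume "S \<in> ?L"
    then obtain i j where ij: "S = pair_union {i, j}" "i < k" "j < k" "i \<noteq> j" "m \<in> S"
      by (auto simp: d_quads_def)
    then have "m div 2 = i \<or> m div 2 = j" by (auto simp: pair_union_def)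
    then show "S \<in> ?R"
    proof
      assume "m div 2 = i"
      then show ?thesis using ij by auto
    next
      assume "m div 2 = j"
      then show ?thesis using ij by (auto simp: insert_commute)
    qed
  qed
qed

text \<open>On the level of pair indices the generators are the two-element sets, and these generate
  the even sets: splitting off two elements lowers the cardinality and drives the induction.\<close>

lemma gen_d_quads: "gen (d_quads k) = pair_union ` {J. J \<subseteq> {..<k} \<and> even (card J)}"
proof
  show "gen (d_quads k) \<subseteq> pair_union ` {J. J \<subseteq> {..<k} \<and> even (card J)}"
  proof
    fix D assume "D \<in> gen (d_quads k)"
    then show "D \<in> pair_union ` {J. J \<subseteq> {..<k} \<and> even (card J)}"
    proof (induction rule: gen.induct)
      case gen_empty
      show ?case by (rule image_eqI[of _ _ "{}"]) auto
    next
      case (gen_step B D)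
      then obtain i j J where *: "B = pair_union {i, j}" "i < k" "j < k" "i \<noteq> j"
        "D = pair_union J" "J \<subseteq> {..<k}" "even (card J)"
        by (auto simp: d_quads_def)
      have "finite J" using * finite_subset by blast
      then have "even (card (sym_diff {i, j} J))"
        using *(4,7) even_card_sym_diff[of "{i, j}" J] by simp
      moreover have "sym_diff {i, j} J \<subseteq> {..<k}" using * by blast
      moreover have "sym_diff B D = pair_union (sym_diff {i, j} J)"
        unfolding pair_union_sym_diff * ..
      ultimately show ?case by blast
    qed
  qed
next
  have "pair_union J \<in> gen (d_quads k)" if "J \<subseteq> {..<k}" "even (card J)" for J
    using that
  proof (induction "card J" arbitrary: J rule: less_induct)
    case less
    have fin: "finite J" using less finite_subset by blast
    show ?case
    proof (cases "J = {}")
      case False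
      then obtain i where i: "i \<in> J" by blast
      have "J \<noteq> {i}" using less by auto
      then obtain j where j: "j \<in> J" "j \<noteq> i" using i by blast
      let ?K = "J - {i, j}"
      have "card J = card ?K + 2"
        using i j fin card_Diff_subset[of "{i, j}" J] card_mono[of J "{i, j}"] by simp
      then have "pair_union ?K \<in> gen (d_quads k)"
        using less.prems by (intro less.hyps) auto
      moreover have "pair_union {i, j} \<in> d_quads k" using i j less unfolding d_quads_def by blast
      ultimately have "pair_union (sym_diff {i, j} ?K) \<in> gen (d_quads k)"
        unfolding pair_union_sym_diff by (rule gen_step[rotated])
      moreover have "sym_diff {i, j} ?K = J" using i j by blast
      ultimately show ?thesis by simp
    qed (auto intro: gen_empty)
  qed
  then show "pair_union ` {J. J \<subseteq> {..<k} \<and> even (card J)} \<subseteq> gen (d_quads k)" by blast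
qed

text \<open>A word constant on pairs has support \<open>pair_union J\<close> and weight twice
  \<open>card J\<close>, so divisibility by 4 means that \<open>card J\<close> is even.\<close>

lemma d_code_gen: "d_code k = word [0..<2 * k] ` gen (d_quads k)"
proof -
  have "c \<in> word [0..<2 * k] ` pair_union ` {J. J \<subseteq> {..<k} \<and> even (card J)}" if "c \<in> d_code k" for c
  proof -
    define J where "J = {j. j < k \<and> c $ (2 * j) \<noteq> 0}"
    have c: "c \<in> carrier_vec (2 * k)" "4 dvd wt c" "\<And>j. j < k \<Longrightarrow> c $ (2 * j) = c $ (2 * j + 1)"
      using that by (auto simp: d_code_def)
    have "m \<in> supp c \<longleftrightarrow> m \<in> pair_union J" for m
    proof -
      have "c $ m = c $ (2 * (m div 2))" if "m < 2 * k"
        using c(3)[of "m div 2"] that by (cases "even m") (auto elim!: oddE)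
      then show ?thesis using c(1) by (auto simp: supp_def pair_union_def J_def)
    qed
    then have supp: "supp c = pair_union J" by blast
    then have "even (card J)"
      using c(2) card_pair_union[of J] by (auto simp: wt_eq_card_supp J_def)
    then show ?thesis
      using word_upt_supp[OF c(1)] unfolding supp
      by (intro image_eqI[of _ _ "pair_union J"] imageI) (simp_all add: J_def subset_eq)
  qed
  moreover have "word [0..<2 * k] (pair_union J) \<in> d_code k" if J: "J \<subseteq> {..<k}" "even (card J)" for J
  proof -
    have "finite J" using J finite_subset by blast
    moreover have "supp (word [0..<2 * k] (pair_union J)) = pair_union J"
      using pair_union_subset[OF J(1)] by (auto simp: supp_word_upt)
    ultimately have "wt (word [0..<2 * k] (pair_union J)) = 2 * card J"
      by (simp add: wt_eq_card_supp card_pair_union)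
    then have "4 dvd wt (word [0..<2 * k] (pair_union J))" using J by auto
    then show ?thesis using word_carrier[of "[0..<2 * k]"] by (simp add: d_code_def pair_union_def)
  qed
  ultimately show ?thesis unfolding gen_d_quads by blast
qed

lemma d_code_model:
  assumes "2 \<le> k"
  shows "code_model (d_code k) (2 * k) (d_quads k) (k - 1)"
  unfolding code_model_def
proof (intro conjI ballI allI impI)
  show "d_code k = word [0..<2 * k] ` gen (d_quads k)" by (rule d_code_gen)
  show "S \<subseteq> {..<2 * k}" if "S \<in> d_quads k" for S
  proof -
    obtain i j where "S = pair_union {i, j}" "i < k" "j < k" using \<open>S \<in> d_quads k\<close> by (auto simp: d_quads_def)
    then show ?thesis using pair_union_subset[of "{i, j}" k] by simp
  qed
  show "card {S \<in> d_quads k. m \<in> S} = k - 1" if m: "m < 2 * k" for m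
  proof -
    have "inj_on (\<lambda>j. pair_union {m div 2, j}) ({..<k} - {m div 2})"
    proof (rule inj_onI)
      fix i j assume *: "i \<in> {..<k} - {m div 2}" "j \<in> {..<k} - {m div 2}"
        "pair_union {m div 2, i} = pair_union {m div 2, j}"
      have "2 * i \<in> pair_union {m div 2, i}" by (simp add: pair_union_def)
      then have "2 * i \<in> pair_union {m div 2, j}" using * by simp
      then show "i = j" using * by (simp add: pair_union_def)
    qed
    then show ?thesis unfolding d_quads_at[OF m] using m by (simp add: card_image)
  qed
  show "\<exists>S\<in>d_quads k. m \<in> S \<and> l \<in> S" if m: "m < 2 * k" and l: "l < 2 * k" for m l
  proof -
    obtain j where j: "j < k" "j \<noteq> m div 2" "l div 2 = m div 2 \<or> l div 2 = j"
    proof (cases "l div 2 = m div 2")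
      case True
      \<comment> \<open>When both coordinates lie in one pair, any other pair completes a generator;
        \<open>2 \<le> k\<close> supplies one.\<close>
      have "\<exists>j<k. j \<noteq> m div 2"
        using assms by (intro exI[of _ "if m div 2 = 0 then 1 else 0"]) auto
      then show ?thesis using True that by blast
    next
      case False
      then show ?thesis using that[of "l div 2"] l by simp
    qed
    have "m div 2 < k" using m by simp
    then have "pair_union {m div 2, j} \<in> d_quads k" using j(1,2) unfolding d_quads_def by blast
    moreover have "m \<in> pair_union {m div 2, j}" "l \<in> pair_union {m div 2, j}"
      using j by (auto simp: pair_union_def)
    ultimately show ?thesis by blast
  qed
qed

section \<open>Coordinate equations and tetrad generators of \<open>e7_code\<close> and
  \<open>e8_code\<close>\<close>

lemma sum7: "(\<Sum>i<7. f i) = f 0 + f 1 + f 2 + f 3 + f 4 + f 5 + f 6"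
  for f :: "nat \<Rightarrow> 'a :: comm_monoid_add"
  by (simp add: eval_nat_numeral ac_simps)

lemma scalar_prod7:
  "dim_vec v = 7 \<Longrightarrow> u \<bullet> v = u $ 0 * v $ 0 + u $ 1 * v $ 1 + u $ 2 * v $ 2 + u $ 3 * v $ 3
    + u $ 4 * v $ 4 + u $ 5 * v $ 5 + u $ 6 * v $ 6"
  for u v :: "bit vec"
  unfolding scalar_prod_def by (simp only: atLeast0LessThan sum7)

lemma all_less_3: "(\<forall>i<3. P i) \<longleftrightarrow> P 0 \<and> P 1 \<and> P (2 :: nat)"
  by (auto simp: eval_nat_numeral less_Suc_eq)

lemma hamming_code_iff:
  "c \<in> hamming_code \<longleftrightarrow> c \<in> carrier_vec 7 \<and> c $ 0 + c $ 2 + c $ 4 + c $ 6 = 0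
     \<and> c $ 1 + c $ 2 + c $ 5 + c $ 6 = 0 \<and> c $ 3 + c $ 4 + c $ 5 + c $ 6 = 0"
proof (cases "c \<in> carrier_vec 7")
  case True
  have "hamming_check *\<^sub>v c = 0\<^sub>v 3 \<longleftrightarrow> (\<forall>i<3. row hamming_check i \<bullet> c = 0)"
    by (auto simp: vec_eq_iff hamming_check_def)
  also have "\<dots> \<longleftrightarrow> c $ 0 + c $ 2 + c $ 4 + c $ 6 = 0
     \<and> c $ 1 + c $ 2 + c $ 5 + c $ 6 = 0 \<and> c $ 3 + c $ 4 + c $ 5 + c $ 6 = 0"
    using True
    by (simp add: all_less_3 scalar_prod7 hamming_check_def del: add_bit_eq_xor mult_bit_eq_and)
  finally show ?thesis
    using True by (simp add: hamming_code_def mat_kernel_def hamming_check_def)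
qed (simp add: hamming_code_def mat_kernel_def hamming_check_def)


lemma bit_add_eq_0_iff: "x + y = 0 \<longleftrightarrow> x = y" for x y :: bit
  by (cases x; cases y) auto

text \<open>The code is the row space of \<open>hamming_check\<close>. Coordinates 0, 1, 3 have the
  unit vectors (labels 1, 2, 4) as check columns and are free; each other entry is the sum over the
  binary digits of its label.\<close>

lemma e7_code_iff:
  "v \<in> e7_code \<longleftrightarrow> v \<in> carrier_vec 7 \<and> v $ 2 = v $ 0 + v $ 1 \<and> v $ 4 = v $ 0 + v $ 3
     \<and> v $ 5 = v $ 1 + v $ 3 \<and> v $ 6 = v $ 0 + v $ 1 + v $ 3"
proof
  assume v: "v \<in> e7_code"
  have zero: "v \<bullet> word [0..<7] B = 0" if "word [0..<7] B \<in> hamming_code" for B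
    using v that by (simp add: e7_code_def dual_code_def)
  \<comment> \<open>A basis of the Hamming code, writing the labels 3, 5, 6, 7 as sums of powers of
    two; orthogonality to each word is one of the four equations.\<close>
  have "word [0..<7] {0, 1, 2} \<in> hamming_code" "word [0..<7] {0, 3, 4} \<in> hamming_code"
    "word [0..<7] {1, 3, 5} \<in> hamming_code" "word [0..<7] {0, 1, 3, 6} \<in> hamming_code"
    using word_carrier[of "[0..<7]"] by (simp_all add: hamming_code_iff del: word_carrier)
  from this[THEN zero] show "v \<in> carrier_vec 7 \<and> v $ 2 = v $ 0 + v $ 1 \<and> v $ 4 = v $ 0 + v $ 3
     \<and> v $ 5 = v $ 1 + v $ 3 \<and> v $ 6 = v $ 0 + v $ 1 + v $ 3"
    using v by (simp add: scalar_prod7 bit_add_eq_0_iff e7_code_def dual_code_def del: add_bit_eq_xor mult_bit_eq_and)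
next
  assume v: "v \<in> carrier_vec 7 \<and> v $ 2 = v $ 0 + v $ 1 \<and> v $ 4 = v $ 0 + v $ 3
     \<and> v $ 5 = v $ 1 + v $ 3 \<and> v $ 6 = v $ 0 + v $ 1 + v $ 3"
  have "v \<bullet> w = 0" if w: "w \<in> hamming_code" for w
  proof -
    have "dim_vec w = 7" using w by (simp add: hamming_code_iff)
    \<comment> \<open>The equations present \<open>v\<close> as the combination of the three check
      rows with coefficients \<open>v $ 0\<close>, \<open>v $ 1\<close>,
      \<open>v $ 3\<close>.\<close>
    then have "v \<bullet> w = v $ 0 * (w $ 0 + w $ 2 + w $ 4 + w $ 6) + v $ 1 * (w $ 1 + w $ 2 + w $ 5 + w $ 6)
      + v $ 3 * (w $ 3 + w $ 4 + w $ 5 + w $ 6)"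
      using v by (simp add: scalar_prod7 algebra_simps del: add_bit_eq_xor mult_bit_eq_and)
    then show ?thesis using w by (simp add: hamming_code_iff del: add_bit_eq_xor mult_bit_eq_and)
  qed
  then show "v \<in> e7_code" using v by (simp add: e7_code_def dual_code_def)
qed

lemma e8_code_iff:
  "u \<in> e8_code \<longleftrightarrow> u \<in> carrier_vec 8 \<and> u $ 0 + u $ 2 + u $ 4 + u $ 6 = 0
     \<and> u $ 1 + u $ 2 + u $ 5 + u $ 6 = 0 \<and> u $ 3 + u $ 4 + u $ 5 + u $ 6 = 0 \<and> u $ 7 = (\<Sum>i<7. u $ i)"
    (is "_ \<longleftrightarrow> ?R u")
proof
  assume "u \<in> e8_code"
  then obtain c where c: "c \<in> hamming_code" "u = c @\<^sub>v vec 1 (\<lambda>_. \<Sum>i<7. c $ i)"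
    by (auto simp: e8_code_def)
  then have "dim_vec c = 7" by (simp add: hamming_code_iff del: add_bit_eq_xor)
  then have eq: "u $ i = c $ i" if "i < 7" for i using that c(2) by simp
  have "u $ 7 = (\<Sum>i<7. c $ i)" "dim_vec u = 8" using c(2) \<open>dim_vec c = 7\<close> by simp_all
  then have "u $ 7 = (\<Sum>i<7. u $ i)" "u \<in> carrier_vec 8" using eq by (auto intro: carrier_vecI simp del: add_bit_eq_xor)
  moreover have "u $ 0 = c $ 0" "u $ 1 = c $ 1" "u $ 2 = c $ 2" "u $ 3 = c $ 3" "u $ 4 = c $ 4"
    "u $ 5 = c $ 5" "u $ 6 = c $ 6" by (rule eq, simp)+
  ultimately show "?R u" using c(1) unfolding hamming_code_iff by metis
next
  assume u: "?R u"
  let ?c = "vec 7 (\<lambda>i. u $ i)"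
  have "?c \<in> hamming_code" using u by (simp add: hamming_code_iff del: add_bit_eq_xor)
  moreover have "u = ?c @\<^sub>v vec 1 (\<lambda>_. \<Sum>i<7. ?c $ i)"
  proof (intro eq_vecI)
    fix i assume "i < dim_vec (?c @\<^sub>v vec 1 (\<lambda>_. \<Sum>i<7. ?c $ i))"
    then have "i < 7 \<or> i = 7" by auto
    then show "u $ i = (?c @\<^sub>v vec 1 (\<lambda>_. \<Sum>i<7. ?c $ i)) $ i" using u by auto
  qed (use u in auto)
  ultimately show "u \<in> e8_code" unfolding e8_code_def by blast
qed

text \<open>Label the coordinate \<open>j\<close> by the vector of binary digits of \<open>j + 1\<close> (modulo 8).  The tetrads of
  \<open>e7_code\<close> are the complements of the lines of the Fano plane, those of \<open>e8_code\<close> the affine planes.\<close>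

definition e7_quads :: "nat set set" where
  "e7_quads = set (map set [[0,1,3,6], [1,2,3,4], [0,2,3,5], [3,4,5,6], [0,2,4,6], [1,2,5,6], [0,1,4,5]])"

definition e8_quads :: "nat set set" where
  "e8_quads = set (map set [[0,1,2,7], [1,3,5,7], [0,3,4,7], [2,4,5,7], [0,5,6,7], [1,4,6,7], [2,3,6,7],
     [3,4,5,6], [0,2,4,6], [1,2,5,6], [0,1,3,6], [1,2,3,4], [0,2,3,5], [0,1,4,5]])"

lemma supp_eq_filter: "c \<in> carrier_vec n \<Longrightarrow> supp c = set (filter (\<lambda>i. c $ i = 1) [0..<n])"
  by (auto simp: supp_def)

lemma word_gen_subset:
  assumes "\<And>u v. u \<in> A \<Longrightarrow> v \<in> A \<Longrightarrow> u + v \<in> A" "0\<^sub>v n \<in> A" "\<And>S. S \<in> D \<Longrightarrow> word [0..<n] S \<in> A"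
  shows "word [0..<n] ` gen D \<subseteq> A"
proof -
  have "word [0..<n] E \<in> A" if "E \<in> gen D" for E
    using that by (induction rule: gen.induct) (use assms in \<open>auto simp: word_sym_diff word_empty\<close>)
  then show ?thesis by blast
qed

lemma upt7: "[0..<7] = [0,1,2,3,4,5,6]" and upt8: "[0..<8] = [0,1,2,3,4,5,6,7]"
  by (simp_all add: upt_rec)

lemma e7_code_gen: "e7_code = word [0..<7] ` gen e7_quads"
proof
  show "word [0..<7] ` gen e7_quads \<subseteq> e7_code"
  proof (rule word_gen_subset)
    show "u + v \<in> e7_code" if "u \<in> e7_code" "v \<in> e7_code" for u v
    proof -
      have "dim_vec u = 7" "dim_vec v = 7" using that by (simp_all add: e7_code_iff del: add_bit_eq_xor)
      then have add: "(u + v) $ i = u $ i + v $ i" if "i < 7" for i using that by simp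
      have "u + v \<in> carrier_vec 7" using that by (simp add: e7_code_iff del: add_bit_eq_xor)
      then show ?thesis using that by (simp add: e7_code_iff add ac_simps del: add_bit_eq_xor index_add_vec)
    qed
    show "word [0..<7] S \<in> e7_code" if "S \<in> e7_quads" for S
    proof -
      have "\<forall>S\<in>e7_quads. word [0..<7] S \<in> e7_code"
        by (simp add: e7_quads_def e7_code_iff word_upt_carrier index_word_upt
            del: upt_rec_numeral dim_word index_word)
      then show ?thesis using that by blast
    qed
  qed (simp add: e7_code_iff)
  show "e7_code \<subseteq> word [0..<7] ` gen e7_quads"
  proof
    fix v assume v: "v \<in> e7_code"
    then have c: "v \<in> carrier_vec 7" by (simp add: e7_code_iff)
    \<comment> \<open>Three free coordinates give eight words: zero and the seven tetrads.\<close>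
    have "supp v = {} \<or> supp v \<in> e7_quads"
      using v unfolding supp_eq_filter[OF c] upt7 e7_code_iff
      by (cases "v $ 0"; cases "v $ 1"; cases "v $ 3") (simp_all add: e7_quads_def insert_commute)
    then have "supp v \<in> gen e7_quads" by (auto intro: gen_empty gen_base)
    then show "v \<in> word [0..<7] ` gen e7_quads" using word_upt_supp[OF c] by (metis image_eqI)
  qed
qed

lemma e8_code_gen: "e8_code = word [0..<8] ` gen e8_quads"
proof
  show "word [0..<8] ` gen e8_quads \<subseteq> e8_code"
  proof (rule word_gen_subset)
    show "u + v \<in> e8_code" if u: "u \<in> e8_code" and v: "v \<in> e8_code" for u v
    proof -
      have dim: "dim_vec u = 8" "dim_vec v = 8" using u v by (simp_all add: e8_code_iff del: add_bit_eq_xor)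
      have quad: "(u + v) $ i + (u + v) $ j + (u + v) $ k + (u + v) $ l = 0"
        if "u $ i + u $ j + u $ k + u $ l = 0" "v $ i + v $ j + v $ k + v $ l = 0"
          "i < 8" "j < 8" "k < 8" "l < 8" for i j k l
      proof -
        have "(u + v) $ i + (u + v) $ j + (u + v) $ k + (u + v) $ l
          = (u $ i + u $ j + u $ k + u $ l) + (v $ i + v $ j + v $ k + v $ l)"
          using dim that(3-) by (simp add: ac_simps del: add_bit_eq_xor)
        then show ?thesis using that by simp
      qed
      have "(\<Sum>i<7. (u + v) $ i) = (\<Sum>i<7. u $ i) + (\<Sum>i<7. v $ i)"
      proof -
        have "(\<Sum>i<7. (u + v) $ i) = (\<Sum>i<7. u $ i + v $ i)"
          using dim by (intro sum.cong) (simp_all del: add_bit_eq_xor)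
        then show ?thesis by (simp only: sum.distrib)
      qed
      moreover have "(u + v) $ 7 = u $ 7 + v $ 7" using dim by (simp del: add_bit_eq_xor)
      ultimately have "(u + v) $ 7 = (\<Sum>i<7. (u + v) $ i)"
        using u v unfolding e8_code_iff by metis
      then show ?thesis using u v unfolding e8_code_iff
        by (intro conjI quad add_carrier_vec) simp_all
    qed
    show "word [0..<8] S \<in> e8_code" if "S \<in> e8_quads" for S
    proof -
      have "\<forall>S\<in>e8_quads. word [0..<8] S \<in> e8_code"
        by (simp add: e8_quads_def e8_code_iff sum7 word_upt_carrier index_word_upt
            del: upt_rec_numeral dim_word index_word)
      then show ?thesis using that by blast
    qed
  qed (simp add: e8_code_iff)
  show "e8_code \<subseteq> word [0..<8] ` gen e8_quads"
  proof
    fix u assume u: "u \<in> e8_code"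
    then have c: "u \<in> carrier_vec 8" by (simp add: e8_code_iff)
    \<comment> \<open>The all-one word is the only nonzero codeword that is not a tetrad; it is a
      sum of two complementary planes.\<close>
    have "{0,1,2,7} \<in> gen e8_quads" "{3,4,5,6} \<in> gen e8_quads"
      by (intro gen_base; simp add: e8_quads_def)+
    moreover have "sym_diff {0,1,2,7} {3,4,5,6} = {0,1,2,3,4,5,6,7::nat}" by auto
    ultimately have all: "{0,1,2,3,4,5,6,7} \<in> gen e8_quads" using gen_sym_diff by metis
    have eqs: "u $ 0 = u $ 2 + u $ 4 + u $ 6" "u $ 1 = u $ 2 + u $ 5 + u $ 6"
      "u $ 3 = u $ 4 + u $ 5 + u $ 6" "u $ 7 = u $ 0 + u $ 1 + u $ 2 + u $ 3 + u $ 4 + u $ 5 + u $ 6"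
      using u by (simp_all add: e8_code_iff sum7 add.assoc bit_add_eq_0_iff del: add_bit_eq_xor)
    have "supp u = {} \<or> supp u \<in> e8_quads \<or> supp u = {0,1,2,3,4,5,6,7}"
      using eqs unfolding supp_eq_filter[OF c] upt8
      by (cases "u $ 2"; cases "u $ 4"; cases "u $ 5"; cases "u $ 6") (simp_all add: e8_quads_def insert_commute)
    then have "supp u \<in> gen e8_quads" using all by (auto intro: gen_empty gen_base)
    then show "u \<in> word [0..<8] ` gen e8_quads" using word_upt_supp[OF c] by (metis image_eqI)
  qed
qed

lemma card_quads_filter:
  "distinct L \<Longrightarrow> card {S \<in> set L. i \<in> S} = length (filter (\<lambda>S. i \<in> S) L)"
  by (metis distinct_card distinct_filter set_filter)

lemma e7_code_model: "code_model e7_code 7 e7_quads 4"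
proof -
  have less: "i < 7 \<longleftrightarrow> i \<in> {0,1,2,3,4,5,6}" for i :: nat by auto
  have "\<forall>i\<in>{0,1,2,3,4,5,6}. card {S \<in> e7_quads. i \<in> S} = 4"
  proof -
    have "distinct (map set [[0,1,3,6::nat], [1,2,3,4], [0,2,3,5], [3,4,5,6], [0,2,4,6], [1,2,5,6], [0,1,4,5]])"
      by (simp add: set_eq_subset)
    from card_quads_filter[OF this] show ?thesis
      unfolding e7_quads_def by simp
  qed
  moreover have "\<forall>i\<in>{0,1,2,3,4,5,6}. \<forall>j\<in>{0,1,2,3,4,5,6}. \<exists>S\<in>e7_quads. i \<in> S \<and> j \<in> S"
    by (simp add: e7_quads_def)
  moreover have "\<forall>S\<in>e7_quads. S \<subseteq> {..<7}"
    by (simp add: e7_quads_def)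
  ultimately show ?thesis
    unfolding code_model_def less using e7_code_gen by blast
qed

lemma e8_code_model: "code_model e8_code 8 e8_quads 7"
proof -
  have less: "i < 8 \<longleftrightarrow> i \<in> {0,1,2,3,4,5,6,7}" for i :: nat by auto
  have "\<forall>i\<in>{0,1,2,3,4,5,6,7}. card {S \<in> e8_quads. i \<in> S} = 7"
  proof -
    have "distinct (map set [[0,1,2,7::nat], [1,3,5,7], [0,3,4,7], [2,4,5,7], [0,5,6,7], [1,4,6,7], [2,3,6,7], [3,4,5,6], [0,2,4,6], [1,2,5,6], [0,1,3,6], [1,2,3,4], [0,2,3,5], [0,1,4,5]])"
      by (simp add: set_eq_subset)
    from card_quads_filter[OF this] show ?thesis
      unfolding e8_quads_def by simp
  qed
  moreover have "\<forall>i\<in>{0,1,2,3,4,5,6,7}. \<forall>j\<in>{0,1,2,3,4,5,6,7}. \<exists>S\<in>e8_quads. i \<in> S \<and> j \<in> S"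
    by (simp add: e8_quads_def)
  moreover have "\<forall>S\<in>e8_quads. S \<subseteq> {..<8}"
    by (simp add: e8_quads_def)
  ultimately show ?thesis
    unfolding code_model_def less using e8_code_gen by blast
qed

section \<open>The component of a point\<close>

text \<open>The Booleans record which points of a Fano plane with lines abd, bce, acf, def, aeg,
  bfg, cdg belong to a set; each hypothesis says that a line is met oddly. Such a set is a line or
  the whole plane.\<close>

lemma fano_plane_parity:
  assumes "a = (b \<longleftrightarrow> d)" "b = (c \<longleftrightarrow> e)" "a = (c \<longleftrightarrow> f)" "d = (e \<longleftrightarrow> f)" "a = (e \<longleftrightarrow> g)"
    "b = (f \<longleftrightarrow> g)" "c = (d \<longleftrightarrow> g)"
  shows "a \<and> b \<and> d \<or> b \<and> c \<and> e \<or> a \<and> c \<and> f \<or> d \<and> e \<and> f \<or> a \<and> e \<and> g \<or> b \<and> f \<and> g \<or> c \<and> d \<and> g"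
  using assms by argo

text \<open>Four lines abd, bce, acf, def form a complete quadrilateral. A set meeting each oddly
  but containing none meets each exactly once; every vertex is on two lines, so the set is a pair of
  opposite vertices.\<close>

lemma quadrilateral_parity:
  assumes "a = (b \<longleftrightarrow> d)" "b = (c \<longleftrightarrow> e)" "a = (c \<longleftrightarrow> f)" "d = (e \<longleftrightarrow> f)"
    and "\<not> (a \<and> b \<and> d)" "\<not> (b \<and> c \<and> e)" "\<not> (a \<and> c \<and> f)" "\<not> (d \<and> e \<and> f)"
  shows "a \<and> e \<and> \<not> b \<and> \<not> c \<and> \<not> d \<and> \<not> f \<or> b \<and> f \<and> \<not> a \<and> \<not> c \<and> \<not> d \<and> \<not> e
    \<or> c \<and> d \<and> \<not> a \<and> \<not> b \<and> \<not> e \<and> \<not> f"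
  using assms by argo

text \<open>All that the local analysis retains of the code; \<open>regular\<close> is the only
  trace of the moment computation.\<close>

locale tetrad_family =
  fixes n r :: nat and T :: "nat set set"
  assumes card_quad: "B \<in> T \<Longrightarrow> card B = 4"
    and quad_subset: "B \<in> T \<Longrightarrow> B \<subseteq> {..<n}"
    and even_inter: "A \<in> T \<Longrightarrow> B \<in> T \<Longrightarrow> even (card (A \<inter> B))"
    and quad_sum: "A \<in> T \<Longrightarrow> B \<in> T \<Longrightarrow> card (A \<inter> B) = 2 \<Longrightarrow> sym_diff A B \<in> T"
    and regular: "x < n \<Longrightarrow> card {B \<in> T. x \<in> B} = r"
begin

lemma finite_quads: "finite T"
  by (rule finite_subset[of _ "Pow {..<n}"]) (use quad_subset in auto)

lemma finite_quad: "B \<in> T \<Longrightarrow> finite B"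
  using quad_subset finite_subset by blast

text \<open>The copy of \<open>D\<close> already contains \<open>r\<close> tetrads through each of its points, so \<open>T\<close>
  has no others there.\<close>

lemma component_of_model:
  assumes model: "code_model A m D r"
    and f: "inj_on f {..<m}" "f ` {..<m} \<subseteq> {..<n}" and D: "\<And>S. S \<in> D \<Longrightarrow> f ` S \<in> T"
  shows "component T A (map f [0..<m])"
    and "i < m \<Longrightarrow> f ` {..<m} \<subseteq> \<Union> {B \<in> T. f i \<in> B}"
proof -
  have sub: "S \<subseteq> {..<m}" if "S \<in> D" for S using model that by (simp add: code_model_def)
  have inj: "inj_on ((`) f) D"
    using inj_on_subset[OF inj_on_image_Pow[OF f(1)]] sub by blast
  have at: "{B \<in> T. f i \<in> B} = (`) f ` {S \<in> D. i \<in> S}" if "i < m" for i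
  proof (rule card_subset_eq[symmetric])
    show "finite {B \<in> T. f i \<in> B}" using finite_quads by simp
    show "(`) f ` {S \<in> D. i \<in> S} \<subseteq> {B \<in> T. f i \<in> B}" using D by auto
    have "card ((`) f ` {S \<in> D. i \<in> S}) = card {S \<in> D. i \<in> S}"
      by (rule card_image) (rule inj_on_subset[OF inj], auto)
    moreover have "f i < n" using f(2) that by auto
    ultimately show "card ((`) f ` {S \<in> D. i \<in> S}) = card {B \<in> T. f i \<in> B}"
      using model that regular by (simp add: code_model_def)
  qed
  have hit: "B \<in> (`) f ` D" if B: "B \<in> T" "B \<inter> f ` {..<m} \<noteq> {}" for B
  proof -
    obtain i where "i < m" "f i \<in> B" using B(2) by blast
    then show ?thesis using at[of i] B(1) by blast
  qed
  have nonempty: "B \<noteq> {}" if "B \<in> T" for B using card_quad[OF that] by auto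
  have set: "set (map f [0..<m]) = f ` {..<m}" by (simp add: atLeast0LessThan)
  have inside: "{B \<in> T. B \<subseteq> f ` {..<m}} = (`) f ` D"
  proof
    show "{B \<in> T. B \<subseteq> f ` {..<m}} \<subseteq> (`) f ` D"
    proof
      fix B assume "B \<in> {B \<in> T. B \<subseteq> f ` {..<m}}"
      then have B: "B \<in> T" "B \<subseteq> f ` {..<m}" by simp_all
      then have "B \<inter> f ` {..<m} \<noteq> {}" using nonempty[OF B(1)] by blast
      then show "B \<in> (`) f ` D" by (rule hit[OF B(1)])
    qed
    show "(`) f ` D \<subseteq> {B \<in> T. B \<subseteq> f ` {..<m}}"
    proof
      fix B assume "B \<in> (`) f ` D"
      then obtain S where "S \<in> D" "B = f ` S" by blast
      then show "B \<in> {B \<in> T. B \<subseteq> f ` {..<m}}" using D[of S] image_mono[OF sub[of S]] by simp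
    qed
  qed
  have gen_D: "gen ((`) f ` D) = (`) f ` gen D" by (rule gen_image[OF f(1) sub])
  show "component T A (map f [0..<m])"
    unfolding component_def set
  proof (intro conjI ballI impI)
    show "distinct (map f [0..<m])" using f(1) by (simp add: distinct_map atLeast0LessThan)
    show "B \<subseteq> f ` {..<m}" if "B \<in> T" "B \<inter> f ` {..<m} \<noteq> {}" for B
      using hit[OF that] sub by blast
    have "word [0..<m] E = word (map f [0..<m]) (f ` E)" if "E \<in> gen D" for E
    proof (intro eq_vecI)
      fix i assume "i < dim_vec (word (map f [0..<m]) (f ` E))"
      then have "i < m" by simp
      moreover have "E \<subseteq> {..<m}" using gen_subset[OF that] sub by blast
      ultimately show "word [0..<m] E $ i = word (map f [0..<m]) (f ` E) $ i"
        using f(1) by (simp add: inj_on_image_mem_iff[of f "{..<m}"])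
    qed simp
    then show "A = word (map f [0..<m]) ` gen {B \<in> T. B \<subseteq> f ` {..<m}}"
      using model unfolding inside gen_D code_model_def image_image
      by (simp cong: image_cong)
  qed
  \<comment> \<open>Needed later to keep a component inside any set that is closed under the tetrads
    meeting it.\<close>
  show "f ` {..<m} \<subseteq> \<Union> {B \<in> T. f i \<in> B}" if i: "i < m"
  proof
    fix y assume "y \<in> f ` {..<m}"
    then obtain j where j: "j < m" "y = f j" by auto
    then obtain S where "S \<in> D" "i \<in> S" "j \<in> S" using model i unfolding code_model_def by blast
    then show "y \<in> \<Union> {B \<in> T. f i \<in> B}" using D j by blast
  qed
qed

section \<open>Sums, parities and intersections of tetrads\<close>

lemma quad_sum4:
  assumes "A \<in> T" "B \<in> T" "A = {p, q, s, t}" "B = {p, q, u, v}" "distinct [p, q, s, t, u, v]"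
  shows "{s, t, u, v} \<in> T"
proof -
  have "A \<inter> B = {p, q}" using assms by auto
  then have "card (A \<inter> B) = 2" using assms by simp
  then have "sym_diff A B \<in> T" using quad_sum assms by blast
  moreover have "sym_diff A B = {s, t, u, v}" using assms by auto
  ultimately show ?thesis by simp
qed

lemma quad_parity:
  assumes "{p, q, s, t} \<in> T" "B \<in> T" "distinct [p, q, s, t]"
  shows "((p \<in> B) = (q \<in> B)) = ((s \<in> B) = (t \<in> B))"
proof -
  have "even (card ({p, q, s, t} \<inter> B))" by (rule even_inter[OF assms(1,2)])
  then show ?thesis
    using assms(3) by (cases "p \<in> B"; cases "q \<in> B"; cases "s \<in> B"; cases "t \<in> B") auto
qed

text \<open>Since \<open>x\<close> is common to both tetrads, an odd number of the other three
  points lies in \<open>B\<close>; for three Booleans this is the stated equivalence.\<close>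

lemma quad_parity_at:
  assumes "{x, q, s, t} \<in> T" "B \<in> T" "x \<in> B" "distinct [x, q, s, t]"
  shows "(q \<in> B) = ((s \<in> B) = (t \<in> B))"
  using quad_parity[OF assms(1,2,4)] assms(3) by simp

text \<open>A nonempty even intersection has 2 or 4 points, and 4 would force equality.\<close>

lemma quads_meet:
  assumes "A \<in> T" "B \<in> T" "A \<noteq> B" "x \<in> A" "x \<in> B"
  obtains y where "y \<noteq> x" "A \<inter> B = {x, y}"
proof -
  have fin: "finite A" "finite B" using finite_quad assms by auto
  have "card (A \<inter> B) \<noteq> 4"
  proof
    assume "card (A \<inter> B) = 4"
    then have "A \<inter> B = A" "A \<inter> B = B"
      using card_subset_eq[OF fin(1)] card_subset_eq[OF fin(2)] card_quad assms by simp_all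
    then show False using assms by blast
  qed
  moreover have "card (A \<inter> B) \<le> 4" using card_mono[of A "A \<inter> B"] card_quad[OF assms(1)] fin by simp
  moreover have "card (A \<inter> B) \<noteq> 0" using assms fin by auto
  moreover have "even (card (A \<inter> B))" using even_inter assms by blast
  ultimately have "card (A \<inter> B) = 2" by presburger
  then obtain u v where "A \<inter> B = {u, v}" "u \<noteq> v" unfolding card_2_iff by blast
  moreover have "x \<in> A \<inter> B" using assms by blast
  ultimately show ?thesis using that by (metis doubleton_eq_iff insertE singletonD)
qed

lemma quad_eqI:
  assumes "B \<in> T" "p \<in> B" "q \<in> B" "s \<in> B" "t \<in> B" "distinct [p, q, s, t]"
  shows "B = {p, q, s, t}"
proof (rule card_subset_eq[symmetric])
  show "finite B" using finite_quad assms by blast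
  show "card {p, q, s, t} = card B" using assms card_quad by simp
qed (use assms in auto)

lemma quad_fourth:
  assumes "B \<in> T" "x \<in> B" "u \<in> B" "v \<in> B" "distinct [x, u, v]"
  shows "\<exists>w. B = {x, u, v, w} \<and> w \<notin> {x, u, v}"
proof -
  have "card (B - {x, u, v}) = 1" using assms card_quad[OF assms(1)] by (simp add: card_Diff_subset)
  then obtain w where "B - {x, u, v} = {w}" using card_1_singletonE by blast
  then have "B = {x, u, v, w} \<and> w \<notin> {x, u, v}" using assms by blast
  then show ?thesis by blast
qed

text \<open>With \<open>y\<close> common to all tetrads through \<open>x\<close>, these are {x, y}
  joined to \<open>r\<close> disjoint pairs. Together with {x, y} this makes \<open>r + 1\<close>
  pairs, any two of which form a tetrad, as in \<open>d_quads\<close>.\<close>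

lemma component_d:
  assumes x: "x < n" and xy: "y \<noteq> x" and r: "0 < r"
    and sunflower: "\<And>B. B \<in> T \<Longrightarrow> x \<in> B \<Longrightarrow> y \<in> B"
  shows "\<exists>xs. component T (d_code (r + 1)) xs \<and> length xs = 2 * (r + 1) \<and> x \<in> set xs
    \<and> set xs \<subseteq> \<Union> {B \<in> T. x \<in> B}"
proof -
  let ?Tx = "{B \<in> T. x \<in> B}"
  have "\<exists>p q. B = {x, y, p, q} \<and> distinct [x, y, p, q]" if "B \<in> ?Tx" for B
  proof -
    have B: "{x, y} \<subseteq> B" "card B = 4" using that sunflower card_quad by auto
    then have "card (B - {x, y}) = 2" using xy card_Diff_subset[of "{x, y}" B] by auto
    then obtain p q where "B - {x, y} = {p, q}" "p \<noteq> q" unfolding card_2_iff by blast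
    then have "B = {x, y, p, q} \<and> distinct [x, y, p, q]" using B(1) xy by auto
    then show ?thesis by blast
  qed
  then obtain p q where pq: "\<And>B. B \<in> ?Tx \<Longrightarrow> B = {x, y, p B, q B} \<and> distinct [x, y, p B, q B]"
    by metis
  have "finite ?Tx" using finite_quads by simp
  then obtain h where h: "bij_betw h {0..<r} ?Tx"
    using ex_bij_betw_nat_finite regular[OF x] by metis
  \<comment> \<open>Pair 0 is (x, y) and pair j + 1 is the rest of the j-th tetrad through
    \<open>x\<close>; \<open>f\<close> lists the pairs consecutively, so that \<open>U i\<close> is
    the image of the coordinates 2i and 2i + 1.\<close>
  define P where "P i = (case i of 0 \<Rightarrow> (x, y) | Suc j \<Rightarrow> (p (h j), q (h j)))" for i
  define f where "f m = (if even m then fst else snd) (P (m div 2))" for m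
  define U where "U i = {fst (P i), snd (P i)}" for i
  have hT: "h i \<in> T" "x \<in> h i" if "i < r" for i using h that by (auto simp: bij_betw_def)
  have U0: "U 0 = {x, y}" by (simp add: U_def P_def)
  have USuc: "h i = {x, y, p (h i), q (h i)}" "distinct [x, y, p (h i), q (h i)]"
    "U (Suc i) = {p (h i), q (h i)}" "U (Suc i) \<subseteq> h i" if "i < r" for i
  proof -
    have "h i \<in> ?Tx" using hT[OF that] by simp
    then have *: "h i = {x, y, p (h i), q (h i)} \<and> distinct [x, y, p (h i), q (h i)]" by (rule pq)
    show U: "U (Suc i) = {p (h i), q (h i)}" by (simp add: U_def P_def)
    show "h i = {x, y, p (h i), q (h i)}" by (rule *[THEN conjunct1])
    then show "U (Suc i) \<subseteq> h i" unfolding U by blast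
    show "distinct [x, y, p (h i), q (h i)]" by (rule *[THEN conjunct2])
  qed
  have disj0: "U 0 \<inter> U (Suc i) = {}" if "i < r" for i
    using USuc(2)[OF that] unfolding U0 USuc(3)[OF that] by auto
  have disjS: "U (Suc i) \<inter> U (Suc j) = {}" if ij: "i < r" "j < r" "i \<noteq> j" for i j
  proof -
    have "h i \<noteq> h j" using h ij by (auto simp: bij_betw_def inj_on_def)
    then obtain z where "z \<noteq> x" "h i \<inter> h j = {x, z}"
      by (rule quads_meet[OF hT(1)[OF ij(1)] hT(1)[OF ij(2)] _ hT(2)[OF ij(1)] hT(2)[OF ij(2)]])
    moreover have "y \<in> h i \<inter> h j" using sunflower hT[OF ij(1)] hT[OF ij(2)] by blast
    ultimately have "h i \<inter> h j = {x, y}" using xy by blast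
    then have "U (Suc i) \<inter> U (Suc j) \<subseteq> U 0" using USuc(4)[OF ij(1)] USuc(4)[OF ij(2)] unfolding U0 by blast
    then show ?thesis using disj0[OF ij(1)] by blast
  qed
  have disj: "U i \<inter> U j = {}" if "i < r + 1" "j < r + 1" "i \<noteq> j" for i j
    using that disj0 disjS by (cases i; cases j) (auto simp: Int_commute)
  have neq: "fst (P i) \<noteq> snd (P i)" if "i < r + 1" for i
    using that xy USuc(2) by (cases i) (auto simp: P_def)
  have fU: "f m \<in> U (m div 2)" for m by (simp add: f_def U_def)
  have inj: "inj_on f {..<2 * (r + 1)}"
  proof (rule inj_onI)
    fix a b assume ab: "a \<in> {..<2 * (r + 1)}" "b \<in> {..<2 * (r + 1)}" "f a = f b"
    then have lt: "a div 2 < r + 1" "b div 2 < r + 1" by auto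
    have "f a \<in> U (a div 2) \<inter> U (b div 2)" using fU[of a] fU[of b] ab by simp
    then have div: "a div 2 = b div 2" using disj[OF lt] by blast
    then have "even a = even b"
      using neq[OF lt(1)] ab(3) by (auto simp: f_def split: if_splits)
    then show "a = b" using div by (metis even_two_times_div_two odd_two_times_div_two_succ)
  qed
  have fpair: "f ` pair_union {i, j} = U i \<union> U j" for i j
    by (simp add: pair_union_insert f_def U_def insert_commute)
  have UT0: "U 0 \<union> U (Suc i) \<in> T" if "i < r" for i
  proof -
    have "{x, y, p (h i), q (h i)} = U 0 \<union> U (Suc i)" unfolding U0 USuc(3)[OF that] by auto
    then have "h i = U 0 \<union> U (Suc i)" by (rule trans[OF USuc(1)[OF that]])
    then show ?thesis using hT(1)[OF that] by simp
  qed
  \<comment> \<open>In the sum of two tetrads through {x, y} that common pair cancels.\<close>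
  have UTS: "U (Suc i) \<union> U (Suc j) \<in> T" if ij: "i < r" "j < r" "i \<noteq> j" for i j
  proof -
    have "distinct [x, y, p (h i), q (h i), p (h j), q (h j)]"
      using USuc(2)[OF ij(1)] USuc(2)[OF ij(2)] disjS[OF ij]
      unfolding USuc(3)[OF ij(1)] USuc(3)[OF ij(2)] by auto
    then have "{p (h i), q (h i), p (h j), q (h j)} \<in> T"
      using quad_sum4[OF hT(1)[OF ij(1)] hT(1)[OF ij(2)] USuc(1)[OF ij(1)] USuc(1)[OF ij(2)]] by blast
    moreover have "U (Suc i) \<union> U (Suc j) = {p (h i), q (h i), p (h j), q (h j)}"
      unfolding USuc(3)[OF ij(1)] USuc(3)[OF ij(2)] by auto
    ultimately show ?thesis by simp
  qed
  have UT: "U i \<union> U j \<in> T" if "i < r + 1" "j < r + 1" "i \<noteq> j" for i j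
    using that UT0 UTS by (cases i; cases j) (auto simp: Un_commute)
  have D: "f ` S \<in> T" if S: "S \<in> d_quads (r + 1)" for S
  proof -
    obtain i j where "S = pair_union {i, j}" "i < r + 1" "j < r + 1" "i \<noteq> j"
      using S unfolding d_quads_def by blast
    then show ?thesis using UT fpair by simp
  qed
  have model: "code_model (d_code (r + 1)) (2 * (r + 1)) (d_quads (r + 1)) r"
    using d_code_model[of "r + 1"] r by simp
  have range: "f ` {..<2 * (r + 1)} \<subseteq> {..<n}"
  proof
    fix z assume "z \<in> f ` {..<2 * (r + 1)}"
    then obtain m where m: "z = f m" "m < 2 * (r + 1)" by auto
    then have "m div 2 < r + 1" by auto
    moreover obtain j where "j < r + 1" "j \<noteq> m div 2"
      using r by (metis One_nat_def add_gr_0 less_add_same_cancel2 less_one zero_neq_one)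
    ultimately have "U (m div 2) \<union> U j \<in> T" using UT by blast
    then show "z \<in> {..<n}" using quad_subset fU m by blast
  qed
  have f0: "f 0 = x" by (simp add: f_def P_def)
  have "component T (d_code (r + 1)) (map f [0..<2 * (r + 1)])"
    by (rule component_of_model(1)[OF model inj range D])
  moreover have "f ` {..<2 * (r + 1)} \<subseteq> \<Union> ?Tx"
    using component_of_model(2)[OF model inj range D, of 0] f0 by simp
  moreover have "x \<in> f ` {..<2 * (r + 1)}" using f0 by (intro image_eqI[of _ _ 0]) auto
  ultimately show ?thesis
    by (intro exI[of _ "map f [0..<2 * (r + 1)]"]) (simp only: set_map length_map length_upt set_upt atLeast0LessThan diff_zero simp_thms)
qed

lemma component_of_list:
  assumes model: "code_model A m D r" and L: "length L = m" "distinct L" "set L \<subseteq> {..<n}"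
    and D: "\<And>S. S \<in> D \<Longrightarrow> (!) L ` S \<in> T" and x: "x \<in> set L"
  shows "component T A L" "set L \<subseteq> \<Union> {B \<in> T. x \<in> B}"
proof -
  have inj: "inj_on ((!) L) {..<m}" using L by (auto simp: inj_on_def nth_eq_iff_index_eq)
  have img: "(!) L ` {..<m} = set L" using L(1) by (auto simp: set_conv_nth)
  have map: "map ((!) L) [0..<m] = L" using L(1) map_nth by blast
  show "component T A L" using component_of_model(1)[OF model inj _ D] L(3) img map by simp
  obtain i where "i < m" "x = L ! i" using x L(1) by (auto simp: in_set_conv_nth)
  then show "set L \<subseteq> \<Union> {B \<in> T. x \<in> B}" using component_of_model(2)[OF model inj _ D, of i] L(3) img by simp
qed

text \<open>Three tetrads through \<open>x\<close> without a further common point, as the triples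
  \<open>abd, bce, acf\<close>; \<open>x\<close> and these six points carry a copy of the tetrads of \<open>e7_code\<close>.\<close>

definition fano :: "nat \<Rightarrow> nat \<Rightarrow> nat \<Rightarrow> nat \<Rightarrow> nat \<Rightarrow> nat \<Rightarrow> nat \<Rightarrow> bool" where
  "fano x a b c d e f \<longleftrightarrow> distinct [x, a, b, c, d, e, f]
     \<and> {x, a, b, d} \<in> T \<and> {x, b, c, e} \<in> T \<and> {x, a, c, f} \<in> T"

text \<open>The third tetrad is chosen to avoid the second common point \<open>b\<close> of the
  first two. Its own second intersections \<open>a\<close> and \<open>c\<close> with them then
  differ from \<open>b\<close>, and from each other, since a coincidence would lie in both of the
  first two.\<close>

lemma fanoE:
  assumes x: "x < n" and r: "0 < r" and no: "\<And>y. y \<noteq> x \<Longrightarrow> \<exists>B\<in>T. x \<in> B \<and> y \<notin> B"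
  obtains a b c d e f where "fano x a b c d e f"
proof -
  have "{B \<in> T. x \<in> B} \<noteq> {}" using regular[OF x] r by (metis card.empty less_irrefl)
  then obtain B1 where B1: "B1 \<in> T" "x \<in> B1" by blast
  have "card (B1 - {x}) = 3" using card_quad[OF B1(1)] B1 by simp
  then obtain y where "y \<in> B1 - {x}" by (metis card.empty ex_in_conv zero_neq_numeral)
  then obtain B2 where B2: "B2 \<in> T" "x \<in> B2" "B2 \<noteq> B1" using no[of y] by blast
  obtain b where b: "b \<noteq> x" "B1 \<inter> B2 = {x, b}"
    using quads_meet[OF B1(1) B2(1) B2(3)[symmetric] B1(2) B2(2)] .
  obtain B3 where B3: "B3 \<in> T" "x \<in> B3" "b \<notin> B3" using no[OF b(1)] by blast
  have "B1 \<noteq> B3" "B2 \<noteq> B3" using b B3 by blast+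
  then obtain a c where a: "a \<noteq> x" "B1 \<inter> B3 = {x, a}" and c: "c \<noteq> x" "B2 \<inter> B3 = {x, c}"
    using quads_meet[OF B1(1) B3(1) _ B1(2) B3(2)] quads_meet[OF B2(1) B3(1) _ B2(2) B3(2)] by metis
  have mem: "a \<in> B1" "a \<in> B3" "b \<in> B1" "b \<in> B2" "c \<in> B2" "c \<in> B3" using a b c by blast+
  have dist: "distinct [x, a, b, c]" using a b c mem B3 by auto
  obtain d where d: "B1 = {x, a, b, d}" "d \<notin> {x, a, b}" using quad_fourth[of B1 x a b] B1 mem dist by auto
  obtain e where e: "B2 = {x, b, c, e}" "e \<notin> {x, b, c}" using quad_fourth[of B2 x b c] B2 mem dist by auto
  obtain f where f: "B3 = {x, a, c, f}" "f \<notin> {x, a, c}" using quad_fourth[of B3 x a c] B3 mem dist by auto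
  have "d \<notin> B2" "d \<notin> B3" "e \<notin> B1" "e \<notin> B3" "f \<notin> B1" "f \<notin> B2"
  proof -
    have "d \<in> B1" "e \<in> B2" "f \<in> B3" using d(1) e(1) f(1) by simp_all
    then show "d \<notin> B2" "d \<notin> B3" "e \<notin> B1" "e \<notin> B3" "f \<notin> B1" "f \<notin> B2"
      using a(2) b(2) c(2) d(2) e(2) f(2) by blast+
  qed
  then have "distinct [x, a, b, c, d, e, f]" using dist d e f by auto
  then have "fano x a b c d e f" using B1 B2 B3 d e f by (simp add: fano_def)
  then show ?thesis using that by blast
qed

text \<open>The three given tetrads have seven nonzero combinations. These are the missing four: the
  sum of all three, then the pairwise sums.\<close>

lemma fano_quads:
  assumes "fano x a b c d e f"
  shows "{x, d, e, f} \<in> T" "{a, d, c, e} \<in> T" "{b, d, c, f} \<in> T" "{b, e, a, f} \<in> T"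
proof -
  have dist: "distinct [x, a, b, c, d, e, f]" and
    B: "{x, a, b, d} \<in> T" "{x, b, c, e} \<in> T" "{x, a, c, f} \<in> T"
    using assms by (auto simp: fano_def)
  show adce: "{a, d, c, e} \<in> T"
    by (rule quad_sum4[OF B(1,2), of x b]) (use dist in auto)
  show "{b, d, c, f} \<in> T"
    by (rule quad_sum4[OF B(1,3), of x a]) (use dist in auto)
  show "{b, e, a, f} \<in> T"
    by (rule quad_sum4[OF B(2,3), of x c]) (use dist in auto)
  have "{d, e, x, f} \<in> T"
    by (rule quad_sum4[OF adce B(3), of a c]) (use dist in auto)
  then show "{x, d, e, f} \<in> T" by (simp add: insert_commute)
qed

text \<open>Transposing \<open>a\<close> with \<open>b\<close>, or \<open>a\<close> with
  \<open>c\<close>, moves the opposite pairs (b, f) and (c, d) to the place of (a, e), so only one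
  of the three extensions has to be worked out.\<close>

lemma fano_perm:
  assumes "fano x a b c d e f"
  shows "fano x b a c d f e" "fano x c b a e d f"
  using assms by (auto simp: fano_def insert_commute)

text \<open>An embedded copy bounds \<open>r\<close> from below, while \<open>regular_le\<close>
  bounds it from above by an exhaustive list; together they fix \<open>r\<close>.\<close>

lemma card_le_regular:
  assumes inj: "inj_on f {..<m}" and fi: "f i < n" and sub: "\<And>S. S \<in> D \<Longrightarrow> S \<subseteq> {..<m}"
    and D: "\<And>S. S \<in> D \<Longrightarrow> f ` S \<in> T"
  shows "card {S \<in> D. i \<in> S} \<le> r"
proof -
  have "{S \<in> D. i \<in> S} \<subseteq> Pow {..<m}" using sub by auto
  then have "inj_on ((`) f) {S \<in> D. i \<in> S}"
    by (rule inj_on_subset[OF inj_on_image_Pow[OF inj]])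
  then have "card {S \<in> D. i \<in> S} = card ((`) f ` {S \<in> D. i \<in> S})" by (simp add: card_image)
  also have "\<dots> \<le> card {B \<in> T. f i \<in> B}"
    by (rule card_mono) (use finite_quads D in auto)
  finally show ?thesis using regular[OF fi] by simp
qed

lemma regular_le:
  assumes "x < n" "\<And>B. B \<in> T \<Longrightarrow> x \<in> B \<Longrightarrow> B \<in> set E"
  shows "r \<le> length E"
proof -
  have "card {B \<in> T. x \<in> B} \<le> card (set E)" by (rule card_mono) (use assms in auto)
  then show ?thesis using regular[OF assms(1)] card_length[of E] by simp
qed

text \<open>Sums with the new tetrad turn the tetrads at \<open>x\<close> into the seven lines of a
  Fano plane on the remaining points. Any tetrad through \<open>x\<close> meets each of these lines
  oddly, hence contains one and is already listed.\<close>

lemma component_e8: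
  assumes fano: "fano x a b c d e f" and g: "{x, a, e, g} \<in> T" "g \<notin> {x, a, b, c, d, e, f}"
  shows "r = 7 \<and> (\<exists>xs. component T e8_code xs \<and> length xs = 8 \<and> x \<in> set xs
    \<and> set xs \<subseteq> \<Union> {B \<in> T. x \<in> B})"
proof -
  have dist: "distinct [x, a, b, c, d, e, f, g]" and
    B: "{x, a, b, d} \<in> T" "{x, b, c, e} \<in> T" "{x, a, c, f} \<in> T"
    using fano g(2) by (auto simp: fano_def)
  note B' = fano_quads[OF fano]
  have bdeg: "{b, d, e, g} \<in> T"
    by (rule quad_sum4[OF B(1) g(1), of x a]) (use dist in auto)
  have cfeg: "{c, f, e, g} \<in> T"
    by (rule quad_sum4[OF B(3) g(1), of x a]) (use dist in auto)
  have bgxf: "{b, g, x, f} \<in> T"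
    by (rule quad_sum4[OF bdeg B'(1), of d e]) (use dist in auto)
  have cgxd: "{c, g, x, d} \<in> T"
    by (rule quad_sum4[OF cfeg B'(1), of f e]) (use dist in auto)
  have afdg: "{a, f, g, d} \<in> T"
    by (rule quad_sum4[OF B(3) cgxd, of x c]) (use dist in auto)
  have acbg: "{a, c, b, g} \<in> T"
    by (rule quad_sum4[OF B(3) bgxf, of x f]) (use dist in auto)
  \<comment> \<open>With labels 1, 2, 4 for \<open>a\<close>, \<open>b\<close>, \<open>c\<close> and
    0 for \<open>x\<close>, binary addition gives d = 3, f = 5, e = 6, g = 7; position 7 carries
    label 8, read as 0.\<close>
  let ?L = "[a, b, d, c, f, e, g, x]"
  have D: "(!) ?L ` S \<in> T" if "S \<in> e8_quads" for S
  proof -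
    have "{a,b,d,x} \<in> T" "{b,c,e,x} \<in> T" "{a,c,f,x} \<in> T" "{d,f,e,x} \<in> T" "{a,e,g,x} \<in> T"
      "{b,f,g,x} \<in> T" "{d,c,g,x} \<in> T" "{c,f,e,g} \<in> T" "{a,d,f,g} \<in> T" "{b,d,e,g} \<in> T"
      "{a,b,c,g} \<in> T" "{b,d,c,f} \<in> T" "{a,d,c,e} \<in> T" "{a,b,f,e} \<in> T"
      using B B' g(1) bdeg cfeg bgxf cgxd afdg acbg by (simp_all add: insert_commute)
    then have "\<forall>S\<in>e8_quads. (!) ?L ` S \<in> T" by (simp add: e8_quads_def)
    then show ?thesis using that by blast
  qed
  have in_n: "set ?L \<subseteq> {..<n}"
    using quad_subset[OF B(1)] quad_subset[OF B(2)] quad_subset[OF B(3)] quad_subset[OF g(1)] by simp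
  have distL: "distinct ?L" using dist by auto
  have inj: "inj_on ((!) ?L) {..<8}"
    by (rule inj_onI) (use distL nth_eq_iff_index_eq[of ?L] in auto)
  have "card {S \<in> e8_quads. 7 \<in> S} \<le> r"
    by (rule card_le_regular[OF inj _ _ D]) (use in_n e8_code_model in \<open>simp_all add: code_model_def\<close>)
  then have "7 \<le> r" using e8_code_model by (simp add: code_model_def)
  moreover have "r \<le> length [{x,a,b,d}, {x,b,c,e}, {x,a,c,f}, {x,d,e,f}, {x,a,e,g}, {x,b,f,g}, {x,c,d,g}]"
  proof (rule regular_le)
    show "x < n" using in_n by simp
    fix A assume A: "A \<in> T" "x \<in> A"
    have xbfg: "{x, b, f, g} \<in> T" "{x, c, d, g} \<in> T"
      using bgxf cgxd by (simp_all add: insert_commute)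
    note par = quad_parity_at[OF B(1) A] quad_parity_at[OF B(2) A] quad_parity_at[OF B(3) A]
      quad_parity_at[OF B'(1) A] quad_parity_at[OF g(1) A] quad_parity_at[OF xbfg(1) A]
      quad_parity_at[OF xbfg(2) A]
    have eqs: "(a \<in> A) = (b \<in> A \<longleftrightarrow> d \<in> A)" "(b \<in> A) = (c \<in> A \<longleftrightarrow> e \<in> A)" "(a \<in> A) = (c \<in> A \<longleftrightarrow> f \<in> A)"
      "(d \<in> A) = (e \<in> A \<longleftrightarrow> f \<in> A)" "(a \<in> A) = (e \<in> A \<longleftrightarrow> g \<in> A)" "(b \<in> A) = (f \<in> A \<longleftrightarrow> g \<in> A)"
      "(c \<in> A) = (d \<in> A \<longleftrightarrow> g \<in> A)"
      by (rule par; use dist in auto)+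
    consider "a \<in> A" "b \<in> A" "d \<in> A" | "b \<in> A" "c \<in> A" "e \<in> A" | "a \<in> A" "c \<in> A" "f \<in> A"
      | "d \<in> A" "e \<in> A" "f \<in> A" | "a \<in> A" "e \<in> A" "g \<in> A" | "b \<in> A" "f \<in> A" "g \<in> A"
      | "c \<in> A" "d \<in> A" "g \<in> A"
      using fano_plane_parity[OF eqs] by blast
    then show "A \<in> set [{x,a,b,d}, {x,b,c,e}, {x,a,c,f}, {x,d,e,f}, {x,a,e,g}, {x,b,f,g}, {x,c,d,g}]"
      by cases (use quad_eqI[OF A] dist in simp_all)
  qed
  ultimately have r: "r = 7" by simp
  then have model: "code_model e8_code 8 e8_quads r" using e8_code_model by simp
  have "component T e8_code ?L" "set ?L \<subseteq> \<Union> {B \<in> T. x \<in> B}"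
    by (rule component_of_list[OF model _ distL in_n D, of x]; simp)+
  then show ?thesis using r by (intro conjI exI[of _ ?L]) simp_all
qed

text \<open>Either the four known tetrads are all those through \<open>x\<close>, or a further one
  contains exactly one opposite pair of the quadrilateral, and its fourth point is new.\<close>

lemma component_fano:
  assumes fano: "fano x a b c d e f"
  shows "r = 4 \<and> (\<exists>xs. component T e7_code xs \<and> length xs = 7 \<and> x \<in> set xs
      \<and> set xs \<subseteq> \<Union> {B \<in> T. x \<in> B})
    \<or> r = 7 \<and> (\<exists>xs. component T e8_code xs \<and> length xs = 8 \<and> x \<in> set xs
      \<and> set xs \<subseteq> \<Union> {B \<in> T. x \<in> B})"
proof -
  have dist: "distinct [x, a, b, c, d, e, f]" and
    B: "{x, a, b, d} \<in> T" "{x, b, c, e} \<in> T" "{x, a, c, f} \<in> T"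
    using fano by (auto simp: fano_def)
  note B' = fano_quads[OF fano]
  let ?E = "[{x,a,b,d}, {x,b,c,e}, {x,a,c,f}, {x,d,e,f}]"
  show ?thesis
  proof (cases "\<forall>A\<in>T. x \<in> A \<longrightarrow> A \<in> set ?E")
    case True
    \<comment> \<open>Labels 1 to 7 in this order: in each given tetrad the label of the fourth
      point is the binary sum of the other three, as 1 + 2 + 4 = 7 for {a, b, x, d}. Position 3 is
      \<open>x\<close>.\<close>
    let ?L = "[a, b, c, x, e, f, d]"
    have D: "(!) ?L ` S \<in> T" if "S \<in> e7_quads" for S
    proof -
      have "{a,b,x,d} \<in> T" "{b,c,x,e} \<in> T" "{a,c,x,f} \<in> T" "{x,e,f,d} \<in> T" "{a,c,e,d} \<in> T"
        "{b,c,f,d} \<in> T" "{a,b,e,f} \<in> T"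
        using B B' by (simp_all add: insert_commute)
      then have "\<forall>S\<in>e7_quads. (!) ?L ` S \<in> T" by (simp add: e7_quads_def)
      then show ?thesis using that by blast
    qed
    have in_n: "set ?L \<subseteq> {..<n}"
      using quad_subset[OF B(1)] quad_subset[OF B(2)] quad_subset[OF B(3)] by simp
    have distL: "distinct ?L" using dist by auto
    have inj: "inj_on ((!) ?L) {..<7}"
      by (rule inj_onI) (use distL nth_eq_iff_index_eq[of ?L] in auto)
    have "card {S \<in> e7_quads. 3 \<in> S} \<le> r"
      by (rule card_le_regular[OF inj _ _ D]) (use in_n e7_code_model in \<open>simp_all add: code_model_def\<close>)
    then have "4 \<le> r" using e7_code_model by (simp add: code_model_def)
    moreover have "r \<le> length ?E"
      by (rule regular_le[of x]) (use in_n True in simp_all)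
    ultimately have r: "r = 4" by simp
    then have model: "code_model e7_code 7 e7_quads r" using e7_code_model by simp
    have "component T e7_code ?L" "set ?L \<subseteq> \<Union> {B \<in> T. x \<in> B}"
      by (rule component_of_list[OF model _ distL in_n D, of x]; simp)+
    then show ?thesis using r by (intro disjI1 conjI exI[of _ ?L]) simp_all
  next
    case False
    then obtain A where A: "A \<in> T" "x \<in> A" "A \<notin> set ?E" by blast
    have no: "\<not> (a \<in> A \<and> b \<in> A \<and> d \<in> A)" "\<not> (b \<in> A \<and> c \<in> A \<and> e \<in> A)"
      "\<not> (a \<in> A \<and> c \<in> A \<and> f \<in> A)" "\<not> (d \<in> A \<and> e \<in> A \<and> f \<in> A)"
    proof -
      have neq: "A \<noteq> {x,a,b,d}" "A \<noteq> {x,b,c,e}" "A \<noteq> {x,a,c,f}" "A \<noteq> {x,d,e,f}"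
        using A(3) by simp_all
      have *: "\<not> (p \<in> A \<and> q \<in> A \<and> s \<in> A)" if "A \<noteq> {x, p, q, s}" "distinct [x, p, q, s]" for p q s
        using quad_eqI[OF A(1,2) _ _ _ that(2)] that(1) by blast
      show "\<not> (a \<in> A \<and> b \<in> A \<and> d \<in> A)" by (rule *[OF neq(1)]) (use dist in auto)
      show "\<not> (b \<in> A \<and> c \<in> A \<and> e \<in> A)" by (rule *[OF neq(2)]) (use dist in auto)
      show "\<not> (a \<in> A \<and> c \<in> A \<and> f \<in> A)" by (rule *[OF neq(3)]) (use dist in auto)
      show "\<not> (d \<in> A \<and> e \<in> A \<and> f \<in> A)" by (rule *[OF neq(4)]) (use dist in auto)
    qed
    note par = quad_parity_at[OF B(1) A(1,2)] quad_parity_at[OF B(2) A(1,2)]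
      quad_parity_at[OF B(3) A(1,2)] quad_parity_at[OF B'(1) A(1,2)]
    have eqs: "(a \<in> A) = (b \<in> A \<longleftrightarrow> d \<in> A)" "(b \<in> A) = (c \<in> A \<longleftrightarrow> e \<in> A)" "(a \<in> A) = (c \<in> A \<longleftrightarrow> f \<in> A)"
      "(d \<in> A) = (e \<in> A \<longleftrightarrow> f \<in> A)"
      by (rule par; use dist in auto)+
    consider "a \<in> A" "e \<in> A" "b \<notin> A" "c \<notin> A" "d \<notin> A" "f \<notin> A"
      | "b \<in> A" "f \<in> A" "a \<notin> A" "c \<notin> A" "d \<notin> A" "e \<notin> A"
      | "c \<in> A" "d \<in> A" "a \<notin> A" "b \<notin> A" "e \<notin> A" "f \<notin> A"
      using quadrilateral_parity[OF eqs no] by blast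
    then show ?thesis
    proof cases
      case 1
      obtain g where g: "A = {x, a, e, g}" "g \<notin> {x, a, e}"
        using quad_fourth[OF A(1,2) 1(1,2)] dist by auto
      then have "g \<in> A" by simp
      then have "g \<notin> {x, a, b, c, d, e, f}" using g(2) 1 by auto
      then show ?thesis using component_e8[OF fano] g A(1) by simp
    next
      case 2
      obtain g where g: "A = {x, b, f, g}" "g \<notin> {x, b, f}"
        using quad_fourth[OF A(1,2) 2(1,2)] dist by auto
      then have "g \<in> A" by simp
      then have "g \<notin> {x, b, a, c, d, f, e}" using g(2) 2 by auto
      then show ?thesis using component_e8[OF fano_perm(1)[OF fano]] g A(1) by simp
    next
      case 3
      obtain g where g: "A = {x, c, d, g}" "g \<notin> {x, c, d}"
        using quad_fourth[OF A(1,2) 3(1,2)] dist by auto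
      then have "g \<in> A" by simp
      then have "g \<notin> {x, c, b, a, e, d, f}" using g(2) 3 by auto
      then show ?thesis using component_e8[OF fano_perm(2)[OF fano]] g A(1) by simp
    qed
  qed
qed

section \<open>Exhausting the coordinates by components\<close>

definition component_type :: "bit vec set \<Rightarrow> nat \<Rightarrow> bool" where
  "component_type A m \<longleftrightarrow> A = d_code (r + 1) \<and> m = 2 * (r + 1)
     \<or> A = e7_code \<and> m = 7 \<and> r = 4 \<or> A = e8_code \<and> m = 8 \<and> r = 7"

lemma component_exists:
  assumes x: "x < n" and r: "0 < r"
  shows "\<exists>A xs. component T A xs \<and> component_type A (length xs) \<and> x \<in> set xs
    \<and> set xs \<subseteq> \<Union> {B \<in> T. x \<in> B}"
proof (cases "\<exists>y. y \<noteq> x \<and> (\<forall>B\<in>T. x \<in> B \<longrightarrow> y \<in> B)")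
  case True
  then obtain y where "y \<noteq> x" "\<And>B. B \<in> T \<Longrightarrow> x \<in> B \<Longrightarrow> y \<in> B" by blast
  note component_d[OF x this(1) r this(2)]
  then show ?thesis unfolding component_type_def by metis
next
  case False
  then have "\<exists>B\<in>T. x \<in> B \<and> y \<notin> B" if "y \<noteq> x" for y using that by blast
  then obtain a b c d e f where "fano x a b c d e f" by (rule fanoE[OF x r])
  note component_fano[OF this]
  then show ?thesis unfolding component_type_def by metis
qed

text \<open>Induction over sets \<open>W\<close> that no tetrad leaves. The component of a point of
  \<open>W\<close> stays in \<open>W\<close>, being covered by tetrads through that point, and
  removing it keeps the property because no tetrad straddles a component.\<close>

lemma component_partition:
  assumes r: "0 < r"
    and W: "W \<subseteq> {..<n}" "\<And>B. B \<in> T \<Longrightarrow> B \<inter> W \<noteq> {} \<Longrightarrow> B \<subseteq> W"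
  shows "\<exists>L. (\<forall>(A, xs)\<in>set L. component T A xs \<and> component_type A (length xs))
    \<and> distinct (concat (map snd L)) \<and> set (concat (map snd L)) = W"
  using W
proof (induction "card W" arbitrary: W rule: less_induct)
  case less
  show ?case
  proof (cases "W = {}")
    case True
    then show ?thesis by (intro exI[of _ "[]"]) simp
  next
    case False
    then obtain x where x: "x \<in> W" by blast
    then have "x < n" using less.prems by blast
    from component_exists[OF this r] obtain A xs where
      xs: "component T A xs" "component_type A (length xs)" "x \<in> set xs"
        "set xs \<subseteq> \<Union> {B \<in> T. x \<in> B}" by blast
    have "B \<subseteq> W" if "B \<in> {B \<in> T. x \<in> B}" for B using that x less.prems(2) by blast
    then have sub: "set xs \<subseteq> W" using xs(4) by blast
    have fin: "finite W" using less.prems(1) finite_subset by blast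
    have "card (W - set xs) < card W" by (rule psubset_card_mono[OF fin]) (use x xs in blast)
    moreover have "W - set xs \<subseteq> {..<n}" using less.prems(1) by blast
    moreover have "B \<subseteq> W - set xs" if B: "B \<in> T" "B \<inter> (W - set xs) \<noteq> {}" for B
    proof -
      have "B \<subseteq> W" using less.prems(2)[OF B(1)] B(2) by blast
      moreover have "B \<inter> set xs = {}"
      proof (rule ccontr)
        assume "B \<inter> set xs \<noteq> {}"
        then have "B \<subseteq> set xs" using xs(1) B(1) unfolding component_def by blast
        then show False using B(2) by blast
      qed
      ultimately show ?thesis by blast
    qed
    ultimately have "\<exists>L. (\<forall>(A, xs)\<in>set L. component T A xs \<and> component_type A (length xs))
      \<and> distinct (concat (map snd L)) \<and> set (concat (map snd L)) = W - set xs"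
      by (rule less.hyps)
    then obtain L where L: "\<forall>(A, xs)\<in>set L. component T A xs \<and> component_type A (length xs)"
      "distinct (concat (map snd L))" "set (concat (map snd L)) = W - set xs"
      by (elim exE conjE)
    have "set (concat (map snd ((A, xs) # L))) = set xs \<union> set (concat (map snd L))" by simp
    also have "\<dots> = W" unfolding L(3) using sub by blast
    finally have "set (concat (map snd ((A, xs) # L))) = W" .
    moreover have "distinct (concat (map snd ((A, xs) # L)))"
    proof -
      have "set xs \<inter> set (concat (map snd L)) = {}" unfolding L(3) by blast
      then show ?thesis using L(2) xs(1) unfolding component_def
        by (simp only: list.map concat.simps snd_conv distinct_append simp_thms)
    qed
    moreover have "\<forall>(A, xs)\<in>set ((A, xs) # L). component T A xs \<and> component_type A (length xs)"
      using L(1) xs by simp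
    ultimately show ?thesis by blast
  qed
qed

end

section \<open>Classification\<close>

text \<open>Closure under sums is read off from self-duality by bilinearity; an indicator orthogonal
  to all codewords lies in the dual and hence in the code.\<close>

lemma type_II_sets_supp:
  assumes "type_II n C"
  shows "type_II_sets n (supp ` C)"
proof -
  have dual: "C = dual_code n C" and four: "\<And>c. c \<in> C \<Longrightarrow> 4 dvd wt c"
    using assms by (auto simp: type_II_def)
  have carr: "c \<in> carrier_vec n" if "c \<in> C" for c
    using that dual by (auto simp: dual_code_def)
  have orth: "u \<bullet> v = 0" if "u \<in> C" "v \<in> C" for u v
  proof -
    have "u \<in> dual_code n C" using that dual by blast
    then show ?thesis using that(2) by (simp add: dual_code_def)
  qed
  have add: "u + v \<in> C" if uv: "u \<in> C" "v \<in> C" for u v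
  proof -
    have "(u + v) \<bullet> w = 0" if "w \<in> C" for w
      using add_scalar_prod_distrib[OF carr[OF uv(1)] carr[OF uv(2)] carr[OF that]] orth uv that
      by simp
    then have "u + v \<in> dual_code n C" using carr uv by (simp add: dual_code_def)
    then show ?thesis using dual by blast
  qed
  show ?thesis
  proof (rule type_II_sets.intro)
    show "B \<subseteq> {..<n}" if "B \<in> supp ` C" for B
      using that supp_subset carr by blast
    show "sym_diff B D \<in> supp ` C" if BD: "B \<in> supp ` C" "D \<in> supp ` C" for B D
    proof -
      obtain u v where "u \<in> C" "v \<in> C" "B = supp u" "D = supp v" using BD by blast
      then have "sym_diff B D = supp (u + v)" "u + v \<in> C"
        using add supp_add[OF carr carr, of u v] by simp_all
      then show ?thesis by (metis image_eqI)
    qed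
    show "even (card (B \<inter> D))" if "B \<in> supp ` C" "D \<in> supp ` C" for B D
      using that orth scalar_prod_bit carr by blast
    show "A \<in> supp ` C" if A: "A \<subseteq> {..<n}" "\<And>B. B \<in> supp ` C \<Longrightarrow> even (card (A \<inter> B))" for A
    proof -
      have supp: "supp (word [0..<n] A) = A" using A(1) by (auto simp: supp_word_upt)
      have word: "word [0..<n] A \<in> carrier_vec n" by (rule word_upt_carrier)
      have "word [0..<n] A \<bullet> w = 0" if "w \<in> C" for w
        unfolding scalar_prod_bit[OF word carr[OF that]] supp using A(2) that by blast
      then have "word [0..<n] A \<in> dual_code n C" using word by (simp add: dual_code_def)
      then show ?thesis using dual supp by (metis image_eqI)
    qed
    show "4 dvd card B" if "B \<in> supp ` C" for B
      using that four by (auto simp: wt_eq_card_supp)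
  qed
qed

lemma (in type_II_sets) tetrad_family_quads:
  assumes n: "n = 24"
  shows "tetrad_family n (card (quads_at 0)) quads"
proof (rule tetrad_family.intro)
  show "sym_diff A B \<in> quads" if AB: "A \<in> quads" "B \<in> quads" "card (A \<inter> B) = 2" for A B
  proof -
    have fin: "finite A" "finite B" and card: "card A = 4" "card B = 4"
      and F: "A \<in> F" "B \<in> F" using AB(1,2) finite_mem by (auto simp: quads_def)
    have "card (A - B) = 2" "card (B - A) = 2"
      using card AB(3) fin card_Diff_subset_Int[of A B] card_Diff_subset_Int[of B A] by (simp_all add: Int_commute)
    moreover have "card (sym_diff A B) = card (A - B) + card (B - A)"
      using fin by (intro card_Un_disjoint) auto
    ultimately show ?thesis using closed[OF F] by (simp add: quads_def)
  qed
  \<comment> \<open>Coordinate 0 is an arbitrary reference point; equidistribution makes the choice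
    immaterial.\<close>
  show "card {B \<in> quads. x \<in> B} = card (quads_at 0)" if "x < n" for x
    using card_quads_at_eq[OF n that, of 0] n by (simp add: quads_at_def)
qed (auto simp: quads_def dest: sub inter)

lemma concat_filter_mset:
  "mset (concat (map g (filter P L @ filter (\<lambda>x. \<not> P x) L))) = mset (concat (map g L))"
  by (induction L) auto

text \<open>For fixed \<open>r\<close> at most two kinds of summand occur. Their lengths differ, so
  sorting by length groups equal summands, and the total length gives a linear equation for the
  multiplicities.\<close>

lemma two_component_types:
  assumes C: "tetrads C \<subseteq> carrier_vec n"
    and comp: "\<forall>(A, xs)\<in>set L. component (supp ` tetrads C) A xs"
    and dist: "distinct (concat (map snd L))" and set: "set (concat (map snd L)) = {..<n}"
    and types: "\<And>A xs. (A, xs) \<in> set L \<Longrightarrow> A = D \<and> length xs = k \<or> A = E \<and> length xs = l"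
    and kl: "k \<noteq> l"
  obtains a b where "k * a + l * b = n" "has_tetrad_system n C (replicate a D @ replicate b E)"
proof -
  let ?P = "\<lambda>p. length (snd p) = k"
  let ?L1 = "filter ?P L" and ?L2 = "filter (\<lambda>p. \<not> ?P p) L"
  have mset: "mset (concat (map snd (?L1 @ ?L2))) = mset (concat (map snd L))"
    by (rule concat_filter_mset)
  have set': "set (concat (map snd (?L1 @ ?L2))) = {..<n}"
    using mset_eq_setD[OF mset] set by simp
  have dist': "distinct (concat (map snd (?L1 @ ?L2)))"
    using mset_eq_imp_distinct_iff[OF mset] dist by simp
  have "has_tetrad_system n C (map fst (?L1 @ ?L2))"
    by (rule has_tetrad_systemI[OF C _ dist' set']) (use comp in auto)
  moreover have "map fst ?L1 = replicate (length ?L1) D"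
    by (rule replicate_eqI) (use types kl in force)+
  moreover have "map fst ?L2 = replicate (length ?L2) E"
    by (rule replicate_eqI) (use types kl in force)+
  ultimately have "has_tetrad_system n C (replicate (length ?L1) D @ replicate (length ?L2) E)"
    by simp
  moreover have "k * length ?L1 + l * length ?L2 = n"
  proof -
    have "map length (map snd ?L1) = replicate (length ?L1) k"
      by (rule replicate_eqI) auto
    moreover have "map length (map snd ?L2) = replicate (length ?L2) l"
      by (rule replicate_eqI) (use types in force)+
    ultimately have "length (concat (map snd (?L1 @ ?L2))) = k * length ?L1 + l * length ?L2"
      unfolding length_concat map_append sum_list_append by (simp only: sum_list_replicate of_nat_id mult.commute)
    then show ?thesis using distinct_card[OF dist'] unfolding set' by simp
  qed
  ultimately show ?thesis using that by blast
qed

theorem proposition8p1: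
  fixes C :: "bit vec set"
  assumes "type_II 24 C"
  shows "tetrads C = {}
    \<or> has_tetrad_system 24 C (replicate 6 (d_code 2))
    \<or> has_tetrad_system 24 C (replicate 4 (d_code 3))
    \<or> has_tetrad_system 24 C (replicate 3 (d_code 4))
    \<or> has_tetrad_system 24 C (replicate 2 (d_code 6))
    \<or> has_tetrad_system 24 C [d_code 12]
    \<or> has_tetrad_system 24 C (replicate 2 e7_code @ [d_code 5])
    \<or> has_tetrad_system 24 C (replicate 3 e8_code)
    \<or> has_tetrad_system 24 C [e8_code, d_code 8]"
proof -
  interpret type_II_sets 24 "supp ` C" by (rule type_II_sets_supp[OF assms])
  define r where "r = card (quads_at 0)"
  interpret family: tetrad_family 24 r quads
    unfolding r_def by (rule tetrad_family_quads) simp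
  have quads: "quads = supp ` tetrads C"
    by (auto simp: quads_def tetrads_def wt_eq_card_supp)
  have C: "tetrads C \<subseteq> carrier_vec 24"
    using assms by (auto simp: tetrads_def type_II_def dual_code_def)
  show ?thesis
  proof (cases "r = 0")
    case True
    have "quads = {}"
    proof (rule equals0I)
      fix B assume B: "B \<in> quads"
      then have "B \<noteq> {}" using family.card_quad[OF B] by auto
      then obtain x where x: "x \<in> B" by blast
      then have "x < 24" using family.quad_subset[OF B] by blast
      then have "card {B \<in> quads. x \<in> B} = 0" using family.regular True by simp
      then show False using B x family.finite_quads by simp
    qed
    then show ?thesis using quads by simp
  next
    case False
    then have "0 < r" by simp
    then obtain L where L: "\<forall>(A, xs)\<in>set L. component quads A xs \<and> family.component_type A (length xs)"
      "distinct (concat (map snd L))" "set (concat (map snd L)) = {..<24}"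
      using family.component_partition[of "{..<24}"] family.quad_subset by blast
    have comp: "\<forall>(A, xs)\<in>set L. component (supp ` tetrads C) A xs"
      using L(1) unfolding quads by auto
    have types: "A = d_code (r + 1) \<and> length xs = 2 * (r + 1)
        \<or> A = e7_code \<and> length xs = 7 \<and> r = 4 \<or> A = e8_code \<and> length xs = 8 \<and> r = 7"
      if "(A, xs) \<in> set L" for A xs
      using L(1) that unfolding family.component_type_def by blast
    consider "r = 4" | "r = 7" | "r \<noteq> 4" "r \<noteq> 7" by blast
    then show ?thesis
    proof cases
      case 1
      \<comment> \<open>For \<open>r\<close> = 4 the alternative to \<open>e7_code\<close> is
        \<open>d_code 5\<close> of length 10, and a = 2, b = 1 is the only solution.\<close>
      obtain a b where ab: "7 * a + 10 * b = 24"
        "has_tetrad_system 24 C (replicate a e7_code @ replicate b (d_code 5))"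
        by (rule two_component_types[OF C comp L(2,3), of e7_code 7 "d_code 5" 10])
          (use types 1 in force)+
      then have "a = 2" "b = 1" by presburger+
      then show ?thesis using ab(2) by simp
    next
      case 2
      \<comment> \<open>For \<open>r\<close> = 7 the alternative to \<open>e8_code\<close> is
        \<open>d_code 8\<close> of length 16; two solutions remain.\<close>
      obtain a b where ab: "8 * a + 16 * b = 24"
        "has_tetrad_system 24 C (replicate a e8_code @ replicate b (d_code 8))"
        by (rule two_component_types[OF C comp L(2,3), of e8_code 8 "d_code 8" 16])
          (use types 2 in force)+
      then have "a = 3 \<and> b = 0 \<or> a = 1 \<and> b = 1" by presburger
      then show ?thesis using ab(2) by auto
    next
      case 3
      have "map fst L = replicate (length L) (d_code (r + 1))"
        by (rule replicate_eqI) (use types 3 in force)+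
      moreover have "has_tetrad_system 24 C (map fst L)"
        by (rule has_tetrad_systemI[OF C comp L(2,3)])
      ultimately have sys: "has_tetrad_system 24 C (replicate (length L) (d_code (r + 1)))" by simp
      have "map length (map snd L) = replicate (length L) (2 * (r + 1))"
        by (rule replicate_eqI) (use types 3 in force)+
      then have "length (concat (map snd L)) = length L * (2 * (r + 1))"
        unfolding length_concat by (simp only: sum_list_replicate of_nat_id)
      \<comment> \<open>All components have length 2(r + 1), so \<open>r + 1\<close> is a divisor of
        12 greater than 1: one of 2, 3, 4, 6, 12.\<close>
      then have len: "length L * (r + 1) = 12" using distinct_card[OF L(2)] unfolding L(3) by simp
      then have "r + 1 dvd 12" by (metis dvd_triv_right)
      then have "r + 1 \<le> 12" by (rule dvd_imp_le) simp
      then have "r = 1 \<or> r = 2 \<or> r = 3 \<or> r = 5 \<or> r = 6 \<or> r = 8 \<or> r = 9 \<or> r = 10 \<or> r = 11"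
        using False 3 by presburger
      then have "r = 1 \<or> r = 2 \<or> r = 3 \<or> r = 5 \<or> r = 11"
        using \<open>r + 1 dvd 12\<close> by auto
      then show ?thesis
      proof (elim disjE)
        assume r: "r = 1"
        then have "length L = 6" using len by simp
        then show ?thesis using sys r by (simp add: eval_nat_numeral)
      next
        assume r: "r = 2"
        then have "length L = 4" using len by simp
        then show ?thesis using sys r by simp
      next
        assume r: "r = 3"
        then have "length L = 3" using len by simp
        then show ?thesis using sys r by simp
      next
        assume r: "r = 5"
        then have "length L = 2" using len by simp
        then show ?thesis using sys r by simp
      next
        assume r: "r = 11"
        then have "length L = 1" using len by simp
        then show ?thesis using sys r by simp
      qed
    qed
  qed
qed

end
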